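(* Let $x_a\in\mathbb{R}$ be fixed, let $L:[a,b]\times\mathbb{R}^2\to\mathbb{R}$ be differentiable, $\phi:[a,b]\times\mathbb{R}\to\mathbb{R}$ of class $C^1$, $g:[a,b]\times\mathbb{R}^2\to\mathbb{R}$ of class $C^1$ and $\psi:[a,b]\to\mathbb{R}$ differentiable. Let $(x,T)$ be a local minimizer on $D$ of the functional $$\mathcal{J}(x,T)=\int_a^TL[x]_\gamma^{\alpha,\beta}(t)\,dt+\phi(T,x(T))$$ subject to the boundary condition $x(a)=x_a$ and the isoperimetric constraint $$\int_a^Tg[x]_\gamma^{\alpha,\beta}(t)\,dt=\psi(T),$$ and suppose that at least one of the two conditions $$\partial_2g[x]_\gamma^{\alpha,\beta}(t)+D_{\overline\gamma,T}^{\beta(\cdot,\cdot),\alpha(\cdot,\cdot)}\partial_3g[x]_\gamma^{\alpha,\beta}(t)=0,\ t\in[a,T];\qquad \gamma_2\left[{}_aD_t^{\beta(\cdot,\cdot)}\partial_3g[x]_\gamma^{\alpha,\beta}(t)-{}_TD_t^{\beta(\cdot,\cdot)}\partial_3g[x]_\gamma^{\alpha,\beta}(t)\right]=0,\ t\in[T,b]$$ is not verified. Then there exists a constant $\lambda$ such that, with $F=L-\lambda g$, $(x,T)$ satisfies the transversality conditions $$ \begin{cases} F[x]_\gamma^{\alpha,\beta}(T)+\partial_1\phi(T,x(T))+\lambda\psi'(T)\\ \quad+x'(T)\left[\gamma_2\,{}_TI_t^{1-\beta(\cdot,\cdot)}\partial_3F[x]_\gamma^{\alpha,\beta}(t)-\gamma_1\,{}_tI_T^{1-\alpha(\cdot,\cdot)}\partial_3F[x]_\gamma^{\alpha,\beta}(t)\right]_{t=T}=0,\\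 \left[\gamma_1\,{}_tI_T^{1-\alpha(\cdot,\cdot)}\partial_3F[x]_\gamma^{\alpha,\beta}(t)-\gamma_2\,{}_TI_t^{1-\beta(\cdot,\cdot)}\partial_3F[x]_\gamma^{\alpha,\beta}(t)\right]_{t=T}+\partial_2\phi(T,x(T))=0,\\ \gamma_2\left[{}_TI_t^{1-\beta(\cdot,\cdot)}\partial_3F[x]_\gamma^{\alpha,\beta}(t)-{}_aI_t^{1-\beta(\cdot,\cdot)}\partial_3F[x]_\gamma^{\alpha,\beta}(t)\right]_{t=b}=0. \end{cases} $$
   Context: Let $a<b$ be reals, $\alpha,\beta:[a,b]^2\to(0,1)$ continuous functions, and $\gamma=(\gamma_1,\gamma_2)\in[0,1]^2$ with $\gamma_1,\gamma_2$ not both zero; $\overline\gamma=(\gamma_2,\gamma_1)$. For $c\in[a,b]$ and $\delta\in\{\alpha,\beta\}$ define the variable-order Riemann--Liouville integrals $${}_cI_t^{1-\delta(\cdot,\cdot)}f(t)=\int_c^t\frac{(t-\tau)^{-\delta(t,\tau)}}{\Gamma(1-\delta(t,\tau))}f(\tau)\,d\tau\ (t>c),\qquad {}_tI_c^{1-\delta(\cdot,\cdot)}f(t)=\int_t^c\frac{(\tau-t)^{-\delta(\tau,t)}}{\Gamma(1-\delta(\tau,t))}f(\tau)\,d\tau\ (t<c),$$ the Riemann--Liouville derivatives ${}_cD_t^{\delta(\cdot,\cdot)}f(t)=\frac{d}{dt}\,{}_cI_t^{1-\delta(\cdot,\cdot)}f(t)$ and ${}_tD_c^{\delta(\cdot,\cdot)}f(t)=-\frac{d}{dt}\,{}_tI_c^{1-\delta(\cdot,\cdot)}f(t)$,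 and the Caputo derivatives ${}_a^CD_t^{\alpha(\cdot,\cdot)}x(t)={}_aI_t^{1-\alpha(\cdot,\cdot)}x'(t)$ and ${}_t^CD_b^{\beta(\cdot,\cdot)}x(t)=-{}_tI_b^{1-\beta(\cdot,\cdot)}x'(t)$. The combined Caputo fractional derivative is ${}^CD_\gamma^{\alpha(\cdot,\cdot),\beta(\cdot,\cdot)}x(t)=\gamma_1\,{}_a^CD_t^{\alpha(\cdot,\cdot)}x(t)+\gamma_2\,{}_t^CD_b^{\beta(\cdot,\cdot)}x(t)$; for $c\in(a,b]$ the dual derivative is $D_{\overline\gamma,c}^{\beta(\cdot,\cdot),\alpha(\cdot,\cdot)}=\gamma_2\,{}_aD_t^{\beta(\cdot,\cdot)}+\gamma_1\,{}_tD_c^{\alpha(\cdot,\cdot)}$. Notation: $[x]_\gamma^{\alpha,\beta}(t)=\left(t,x(t),{}^CD_\gamma^{\alpha(\cdot,\cdot),\beta(\cdot,\cdot)}x(t)\right)$; $F[x]_\gamma^{\alpha,\beta}(t)$ means $F$ evaluated at this vector; $\partial_iF$ is the partial derivative with respect to the $i$th argument. $D=\{(x,t)\in C^1([a,b])\times[a,b]:\ {}^CD_\gamma^{\alpha(\cdot,\cdot),\beta(\cdot,\cdot)}x\in C([a,b])\}$, with norm $\|(x,t)\|=\max_{[a,b]}|x|+\max_{[a,b]}|{}^CD_\gamma^{\alpha(\cdot,\cdot),\beta(\cdot,\cdot)}x|+|t|$; local minimum is with respect to this norm among admissible pairs of $D$. $T$ and $x(T)$ are free.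
   Formalization: L is also assumed to have continuous partial derivatives in its second and third arguments (otherwise the integrals in the conditions may diverge); T is assumed to lie strictly between a and b; the excluded conditions are read via derivatives of the combined integrals. *)

theory Defs
  imports "HOL-Analysis.Analysis"
begin

definition C1_on :: "'a::real_normed_vector set \<Rightarrow> ('a \<Rightarrow> 'b::real_normed_vector) \<Rightarrow> bool" where
  "C1_on S f \<longleftrightarrow> (\<exists>f' :: 'a \<Rightarrow> 'a \<Rightarrow>\<^sub>L 'b.
     (\<forall>p\<in>S. (f has_derivative blinfun_apply (f' p)) (at p within S)) \<and> continuous_on S f')"

text \<open>Derivative of a function that is only meaningful on the interval from \<open>a\<close> to \<open>b\<close>;
  it is one-sided at the end points.\<close>

definition D_on :: "real \<Rightarrow> real \<Rightarrow> (real \<Rightarrow> real) \<Rightarrow> real \<Rightarrow> real" where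
  "D_on a b x t = vector_derivative x (at t within {a..b})"

text \<open>Left and right Riemann--Liouville integrals of variable order \<open>1 - \<delta>\<close>, with base point \<open>c\<close>.
  For \<open>t = c\<close> the range of integration is a single point and the value is 0.\<close>

definition RL_left_int :: "(real \<Rightarrow> real \<Rightarrow> real) \<Rightarrow> real \<Rightarrow> (real \<Rightarrow> real) \<Rightarrow> real \<Rightarrow> real" where
  "RL_left_int \<delta> c f t =
     (LBINT \<tau>:{c..t}. (t - \<tau>) powr (- \<delta> t \<tau>) / Gamma (1 - \<delta> t \<tau>) * f \<tau>)"

definition RL_right_int :: "(real \<Rightarrow> real \<Rightarrow> real) \<Rightarrow> real \<Rightarrow> (real \<Rightarrow> real) \<Rightarrow> real \<Rightarrow> real" where
  "RL_right_int \<delta> c f t =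
     (LBINT \<tau>:{t..c}. (\<tau> - t) powr (- \<delta> \<tau> t) / Gamma (1 - \<delta> \<tau> t) * f \<tau>)"

text \<open>Riemann--Liouville derivatives as relations: \<open>D\<close> is the derivative at \<open>t\<close> (within \<open>S\<close>).\<close>

definition has_RL_left_deriv ::
  "(real \<Rightarrow> real \<Rightarrow> real) \<Rightarrow> real \<Rightarrow> (real \<Rightarrow> real) \<Rightarrow> real \<Rightarrow> real \<Rightarrow> real set \<Rightarrow> bool" where
  "has_RL_left_deriv \<delta> c f D t S \<longleftrightarrow> (RL_left_int \<delta> c f has_real_derivative D) (at t within S)"

definition has_RL_right_deriv ::
  "(real \<Rightarrow> real \<Rightarrow> real) \<Rightarrow> real \<Rightarrow> (real \<Rightarrow> real) \<Rightarrow> real \<Rightarrow> real \<Rightarrow> real set \<Rightarrow> bool" where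
  "has_RL_right_deriv \<delta> c f D t S \<longleftrightarrow>
     ((\<lambda>s. - RL_right_int \<delta> c f s) has_real_derivative D) (at t within S)"

definition caputo_left ::
  "real \<Rightarrow> real \<Rightarrow> (real \<Rightarrow> real \<Rightarrow> real) \<Rightarrow> (real \<Rightarrow> real) \<Rightarrow> real \<Rightarrow> real" where
  "caputo_left a b \<alpha> x t = RL_left_int \<alpha> a (D_on a b x) t"

definition caputo_right ::
  "real \<Rightarrow> real \<Rightarrow> (real \<Rightarrow> real \<Rightarrow> real) \<Rightarrow> (real \<Rightarrow> real) \<Rightarrow> real \<Rightarrow> real" where
  "caputo_right a b \<beta> x t = - RL_right_int \<beta> b (D_on a b x) t"

definition combined_caputo ::
  "real \<Rightarrow> real \<Rightarrow> (real \<Rightarrow> real \<Rightarrow> real) \<Rightarrow> (real \<Rightarrow> real \<Rightarrow> real) \<Rightarrow> real \<Rightarrow> real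
     \<Rightarrow> (real \<Rightarrow> real) \<Rightarrow> real \<Rightarrow> real" where
  "combined_caputo a b \<alpha> \<beta> \<gamma>1 \<gamma>2 x t =
     \<gamma>1 * caputo_left a b \<alpha> x t + \<gamma>2 * caputo_right a b \<beta> x t"

text \<open>The dual derivative \<open>\<gamma>2 D\<^sub>l + \<gamma>1 D\<^sub>r\<close>, where \<open>D\<^sub>l\<close> is the left derivative of order \<open>\<beta>\<close> based
  at \<open>a\<close> and \<open>D\<^sub>r\<close> the right derivative of order \<open>\<alpha>\<close> based at \<open>c\<close>.  The linear combination is
  taken before differentiating, so that the expression keeps its meaning at points (such as the
  end points \<open>a\<close> and \<open>c\<close>) where the two terms need not be differentiable separately; where they
  are, it is their combination (\<open>has_dual_derivI\<close>).  The same remark applies to the difference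
  \<open>\<gamma>2 (D\<^sub>l - D\<^sub>l')\<close> of the left derivatives based at \<open>a\<close> and at \<open>c\<close>.\<close>

definition has_dual_deriv ::
  "real \<Rightarrow> (real \<Rightarrow> real \<Rightarrow> real) \<Rightarrow> (real \<Rightarrow> real \<Rightarrow> real) \<Rightarrow> real \<Rightarrow> real
     \<Rightarrow> real \<Rightarrow> (real \<Rightarrow> real) \<Rightarrow> real \<Rightarrow> real \<Rightarrow> bool" where
  "has_dual_deriv a \<alpha> \<beta> \<gamma>1 \<gamma>2 c f D t \<longleftrightarrow>
     ((\<lambda>s. \<gamma>2 * RL_left_int \<beta> a f s + \<gamma>1 * - RL_right_int \<alpha> c f s) has_real_derivative D)
       (at t within {a..c})"

definition has_left_diff_deriv ::
  "real \<Rightarrow> real \<Rightarrow> (real \<Rightarrow> real \<Rightarrow> real) \<Rightarrow> real \<Rightarrow> real \<Rightarrow> (real \<Rightarrow> real) \<Rightarrow> real \<Rightarrow> real \<Rightarrow> bool" where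
  "has_left_diff_deriv a b \<beta> \<gamma>2 c f D t \<longleftrightarrow>
     ((\<lambda>s. \<gamma>2 * (RL_left_int \<beta> a f s - RL_left_int \<beta> c f s)) has_real_derivative D)
       (at t within {c..b})"

lemma has_dual_derivI:
  assumes "has_RL_left_deriv \<beta> a f Dl t {a..c}" and "has_RL_right_deriv \<alpha> c f Dr t {a..c}"
  shows "has_dual_deriv a \<alpha> \<beta> \<gamma>1 \<gamma>2 c f (\<gamma>2 * Dl + \<gamma>1 * Dr) t"
  using assms unfolding has_RL_left_deriv_def has_RL_right_deriv_def has_dual_deriv_def
  by (intro DERIV_add DERIV_cmult)

lemma has_left_diff_derivI:
  assumes "has_RL_left_deriv \<beta> a f D1 t {c..b}" and "has_RL_left_deriv \<beta> c f D2 t {c..b}"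
  shows "has_left_diff_deriv a b \<beta> \<gamma>2 c f (\<gamma>2 * (D1 - D2)) t"
  using assms unfolding has_RL_left_deriv_def has_left_diff_deriv_def
  by (intro DERIV_diff DERIV_cmult)

definition pd2 :: "(real \<Rightarrow> real \<Rightarrow> real \<Rightarrow> real) \<Rightarrow> real \<Rightarrow> real \<Rightarrow> real \<Rightarrow> real" where
  "pd2 F t u v = deriv (\<lambda>u. F t u v) u"

definition pd3 :: "(real \<Rightarrow> real \<Rightarrow> real \<Rightarrow> real) \<Rightarrow> real \<Rightarrow> real \<Rightarrow> real \<Rightarrow> real" where
  "pd3 F t u v = deriv (\<lambda>v. F t u v) v"

text \<open>\<open>along a b \<alpha> \<beta> \<gamma>1 \<gamma>2 F x t\<close> is the value of \<open>F\<close> at \<open>(t, x(t), z(t))\<close>, where \<open>z\<close> is the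
  combined Caputo derivative of \<open>x\<close>.\<close>

definition along ::
  "real \<Rightarrow> real \<Rightarrow> (real \<Rightarrow> real \<Rightarrow> real) \<Rightarrow> (real \<Rightarrow> real \<Rightarrow> real) \<Rightarrow> real \<Rightarrow> real
     \<Rightarrow> (real \<Rightarrow> real \<Rightarrow> real \<Rightarrow> real) \<Rightarrow> (real \<Rightarrow> real) \<Rightarrow> real \<Rightarrow> real" where
  "along a b \<alpha> \<beta> \<gamma>1 \<gamma>2 F x t = F t (x t) (combined_caputo a b \<alpha> \<beta> \<gamma>1 \<gamma>2 x t)"

definition frac_space ::
  "real \<Rightarrow> real \<Rightarrow> (real \<Rightarrow> real \<Rightarrow> real) \<Rightarrow> (real \<Rightarrow> real \<Rightarrow> real) \<Rightarrow> real \<Rightarrow> real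
     \<Rightarrow> ((real \<Rightarrow> real) \<times> real) set" where
  "frac_space a b \<alpha> \<beta> \<gamma>1 \<gamma>2 =
     {(x, t). C1_on {a..b} x \<and> t \<in> {a..b} \<and>
              continuous_on {a..b} (combined_caputo a b \<alpha> \<beta> \<gamma>1 \<gamma>2 x)}"

definition frac_norm ::
  "real \<Rightarrow> real \<Rightarrow> (real \<Rightarrow> real \<Rightarrow> real) \<Rightarrow> (real \<Rightarrow> real \<Rightarrow> real) \<Rightarrow> real \<Rightarrow> real
     \<Rightarrow> (real \<Rightarrow> real) \<Rightarrow> real \<Rightarrow> real" where
  "frac_norm a b \<alpha> \<beta> \<gamma>1 \<gamma>2 x t =
     (SUP s\<in>{a..b}. \<bar>x s\<bar>) + (SUP s\<in>{a..b}. \<bar>combined_caputo a b \<alpha> \<beta> \<gamma>1 \<gamma>2 x s\<bar>) + \<bar>t\<bar>"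

definition bolza ::
  "real \<Rightarrow> real \<Rightarrow> (real \<Rightarrow> real \<Rightarrow> real) \<Rightarrow> (real \<Rightarrow> real \<Rightarrow> real) \<Rightarrow> real \<Rightarrow> real
     \<Rightarrow> (real \<Rightarrow> real \<Rightarrow> real \<Rightarrow> real) \<Rightarrow> (real \<Rightarrow> real \<Rightarrow> real) \<Rightarrow> (real \<Rightarrow> real) \<Rightarrow> real \<Rightarrow> real" where
  "bolza a b \<alpha> \<beta> \<gamma>1 \<gamma>2 L \<phi> x T =
     (LBINT t:{a..T}. along a b \<alpha> \<beta> \<gamma>1 \<gamma>2 L x t) + \<phi> T (x T)"

definition admissible ::
  "real \<Rightarrow> real \<Rightarrow> (real \<Rightarrow> real \<Rightarrow> real) \<Rightarrow> (real \<Rightarrow> real \<Rightarrow> real) \<Rightarrow> real \<Rightarrow> real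
     \<Rightarrow> (real \<Rightarrow> real \<Rightarrow> real \<Rightarrow> real) \<Rightarrow> (real \<Rightarrow> real) \<Rightarrow> real
     \<Rightarrow> ((real \<Rightarrow> real) \<times> real) set" where
  "admissible a b \<alpha> \<beta> \<gamma>1 \<gamma>2 g \<psi> xa =
     {(x, T) \<in> frac_space a b \<alpha> \<beta> \<gamma>1 \<gamma>2.
        x a = xa \<and> (LBINT t:{a..T}. along a b \<alpha> \<beta> \<gamma>1 \<gamma>2 g x t) = \<psi> T}"

definition local_minimizer ::
  "real \<Rightarrow> real \<Rightarrow> (real \<Rightarrow> real \<Rightarrow> real) \<Rightarrow> (real \<Rightarrow> real \<Rightarrow> real) \<Rightarrow> real \<Rightarrow> real
     \<Rightarrow> ((real \<Rightarrow> real) \<Rightarrow> real \<Rightarrow> real) \<Rightarrow> ((real \<Rightarrow> real) \<times> real) set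
     \<Rightarrow> (real \<Rightarrow> real) \<Rightarrow> real \<Rightarrow> bool" where
  "local_minimizer a b \<alpha> \<beta> \<gamma>1 \<gamma>2 J A x T \<longleftrightarrow>
     (x, T) \<in> A \<and>
     (\<exists>\<epsilon>>0. \<forall>(y, S)\<in>A. frac_norm a b \<alpha> \<beta> \<gamma>1 \<gamma>2 (\<lambda>s. x s - y s) (T - S) < \<epsilon> \<longrightarrow> J x T \<le> J y S)"

end

theory Submission
  imports Defs
begin

text \<open>Write a variation of \<open>x\<close> as \<open>h(t) = \<integral>\<^sub>a\<^sup>t e\<close> with \<open>e\<close> continuous.  By Fubini, which applies because the
  kernels are weakly singular, the first variation of \<open>\<integral>\<^sub>a\<^sup>T F[x]\<close> becomes \<open>\<integral>\<^sub>a\<^sup>b e V\<close> with a continuous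
  function \<open>V\<close> on \<open>[a, b]\<close>.  The hypothesis on \<open>g\<close> ensures that \<open>V\<close> does not vanish identically for
  \<open>F = g\<close>, so there is a direction in which the constraint is nondegenerate, and a Lagrange multiplier
  \<open>\<lambda>\<close> exists.  For \<open>F = L - \<lambda>g\<close> and \<open>c = \<partial>\<^sub>2\<phi>(T, x(T))\<close> one gets \<open>\<integral>\<^sub>a\<^sup>b e V + c \<integral>\<^sub>a\<^sup>T e = 0\<close> for all \<open>e\<close>;
  hence \<open>V = -c\<close> before \<open>T\<close> and \<open>V = 0\<close> after \<open>T\<close>, and continuity at \<open>T\<close> gives \<open>c = 0\<close>.  As integrals
  over \<open>[T, T]\<close> vanish, this is the second condition; the first one is stationarity in \<open>T\<close>, and
  the third one is \<open>V(b) = 0\<close>.\<close>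

subsection \<open>Weakly singular kernels\<close>

text \<open>\<open>\<partial>\<^sub>3F[x]\<close> is merely continuous, so its Riemann-Liouville
  derivatives need not exist and the first variation cannot be brought into Euler-Lagrange form by
  differentiating it. Taking e = h' as the unknown avoids this: transposing the kernels applies
  operators to \<open>\<partial>\<^sub>2F[x]\<close> and \<open>\<partial>\<^sub>3F[x]\<close> that
  only integrate. Derivatives occur only in the hypothesis on g, where V = 0 itself forces the
  combined expressions to be differentiable. Since h(a) = 0 is the only restriction on h, every
  continuous e is allowed, and V is determined completely rather than up to an additive constant.

  The multiplier comes from a family with two parameters: one moves along an arbitrary pair of a
  variation e of x' and a shift \<tau> of T, the other along a fixed \<open>e0\<close> that leaves T
  alone and changes the constraint to first order. As \<lambda> is computed from \<open>e0\<close>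
  only, it serves all pairs at once; the choices e = 0 and \<tau> = 0 then separate stationarity in
  T from stationarity in x.\<close>

definition triangle :: "real \<Rightarrow> real \<Rightarrow> (real \<times> real) set" where
  "triangle a b = {(t, s). a \<le> s \<and> s < t \<and> t \<le> b}"

text \<open>The kernel is extended by 0 outside the triangle \<open>a \<le> s < t \<le> b\<close>, so that left and right
  integrals are transposes of each other as integrals over the whole line.  Order 0 is allowed
  from here on: it turns the left integral into the ordinary primitive, so that \<open>h(t) = \<integral>\<^sub>a\<^sup>t e\<close> is
  treated like the fractional integrals of \<open>e = h'\<close>.\<close>

definition rl_ker :: "real \<Rightarrow> real \<Rightarrow> (real \<Rightarrow> real \<Rightarrow> real) \<Rightarrow> real \<Rightarrow> real \<Rightarrow> real" where
  "rl_ker a b \<delta> t s = indicator (triangle a b) (t, s) * ((t - s) powr (- \<delta> t s) / Gamma (1 - \<delta> t s))"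

definition left_op :: "real \<Rightarrow> real \<Rightarrow> (real \<Rightarrow> real \<Rightarrow> real) \<Rightarrow> (real \<Rightarrow> real) \<Rightarrow> real \<Rightarrow> real" where
  "left_op a b \<delta> f t = (\<integral>s. rl_ker a b \<delta> t s * f s \<partial>lborel)"

definition right_op :: "real \<Rightarrow> real \<Rightarrow> (real \<Rightarrow> real \<Rightarrow> real) \<Rightarrow> (real \<Rightarrow> real) \<Rightarrow> real \<Rightarrow> real" where
  "right_op a b \<delta> f s = (\<integral>t. rl_ker a b \<delta> t s * f t \<partial>lborel)"

text \<open>Cutting the function instead of the kernel lets one kernel over [a, b] serve every base
  point, in particular T. The price is a possible jump at \<open>c\<close> and \<open>d\<close>,
  which is why the continuity lemmas for the operators admit countably many discontinuities.\<close>

definition cutoff :: "real \<Rightarrow> real \<Rightarrow> (real \<Rightarrow> real) \<Rightarrow> real \<Rightarrow> real" where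
  "cutoff c d f x = indicator {c..d} x * f x"

text \<open>Convergence is demanded only almost everywhere, with an exceptional set depending on
  \<open>t\<close>: after a translation the jumps of the integrand sit at points that move with
  \<open>t\<close>. Passing to sequences makes dominated convergence applicable.\<close>

lemma continuous_on_integral_dominated:
  fixes H :: "real \<Rightarrow> real \<Rightarrow> real"
  assumes w: "integrable lborel w"
    and meas: "\<And>t. t \<in> S \<Longrightarrow> H t \<in> borel_measurable lborel"
    and bound: "\<And>t r. t \<in> S \<Longrightarrow> \<bar>H t r\<bar> \<le> w r"
    and lim: "\<And>t. t \<in> S \<Longrightarrow> AE r in lborel. ((\<lambda>s. H s r) \<longlongrightarrow> H t r) (at t within S)"
  shows "continuous_on S (\<lambda>t. \<integral>r. H t r \<partial>lborel)"
  unfolding continuous_on_eq_continuous_within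
proof safe
  fix t assume t: "t \<in> S"
  show "continuous (at t within S) (\<lambda>t. \<integral>r. H t r \<partial>lborel)"
    unfolding continuous_within tendsto_at_iff_sequentially comp_def
  proof safe
    fix X :: "nat \<Rightarrow> real"
    assume X: "\<forall>i. X i \<in> S - {t}" and Xt: "X \<longlonglongrightarrow> t"
    have F: "filterlim X (at t within S) sequentially"
      using X Xt by (auto simp: filterlim_at)
    show "(\<lambda>n. \<integral>r. H (X n) r \<partial>lborel) \<longlonglongrightarrow> (\<integral>r. H t r \<partial>lborel)"
    proof (rule integral_dominated_convergence[where w = w])
      show "AE r in lborel. (\<lambda>n. H (X n) r) \<longlonglongrightarrow> H t r"
        using lim[OF t] by eventually_elim (rule filterlim_compose[OF _ F])
    qed (use X t meas bound w in auto)
  qed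
qed

lemma integrable_powr_cutoff:
  fixes m c :: real
  assumes "m < 1" "0 \<le> c"
  shows "integrable lborel (\<lambda>r. indicator {0..c} r * r powr (- m))"
proof -
  have "(\<lambda>x. x powr (- m)) absolutely_integrable_on {0..c}"
    using has_integral_powr_from_0[of "-m" c] assms
    by (intro nonnegative_absolutely_integrable_1) (auto simp: integrable_on_def)
  then show ?thesis
    unfolding set_integrable_def by (subst (asm) integrable_completion) auto
qed

lemma integrable_translate:
  fixes w :: "real \<Rightarrow> real"
  assumes "integrable lborel w"
  shows "integrable lborel (\<lambda>s. w (t - s))" "integrable lborel (\<lambda>r. w (r - t))"
    "(\<integral>s. w (t - s) \<partial>lborel) = (\<integral>s. w s \<partial>lborel)"
  using lborel_integrable_real_affine[OF assms, of "-1" t] lborel_integrable_real_affine[OF assms, of 1 "-t"]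
    lborel_integral_real_affine[of "-1" w t]
  by (simp_all add: algebra_simps)

section \<open>Integrability, Fubini and continuity for operators of variable order\<close>

locale variable_order =
  fixes a b :: real and \<delta> :: "real \<Rightarrow> real \<Rightarrow> real"
  assumes ab: "a < b"
    and cont: "continuous_on ({a..b} \<times> {a..b}) (\<lambda>(t, s). \<delta> t s)"
    and range: "\<And>t s. t \<in> {a..b} \<Longrightarrow> s \<in> {a..b} \<Longrightarrow> 0 \<le> \<delta> t s \<and> \<delta> t s < 1"
begin

abbreviation "ker \<equiv> rl_ker a b \<delta>"

lemma continuous_on_ker: "continuous_on (triangle a b) (\<lambda>(t, s). ker t s)"
proof -
  have d: "continuous_on (triangle a b) (\<lambda>p. \<delta> (fst p) (snd p))"
    by (rule continuous_on_subset[OF cont[unfolded case_prod_beta]]) (auto simp: triangle_def)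
  have pos: "0 < 1 - \<delta> (fst p) (snd p)" if "p \<in> triangle a b" for p
    using range[of "fst p" "snd p"] that by (auto simp: triangle_def)
  have G: "continuous_on (triangle a b) (\<lambda>p. Gamma (1 - \<delta> (fst p) (snd p)))"
    by (rule continuous_on_compose2[OF continuous_on_Gamma[of "{0<..}"]])
      (use pos in \<open>auto intro!: continuous_intros d elim!: nonpos_Ints_cases\<close>)
  have "continuous_on (triangle a b)
      (\<lambda>p. (fst p - snd p) powr (- \<delta> (fst p) (snd p)) / Gamma (1 - \<delta> (fst p) (snd p)))"
    by (intro continuous_intros d G ballI less_imp_neq[THEN not_sym] Gamma_real_pos pos) (auto simp: triangle_def)
  then show ?thesis
    by (rule continuous_on_eq) (auto simp: rl_ker_def)
qed

lemma measurable_ker[measurable]: "case_prod ker \<in> borel_measurable (borel \<Otimes>\<^sub>M borel)"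
proof -
  have "triangle a b = {p \<in> space (borel \<Otimes>\<^sub>M borel). a \<le> snd p \<and> snd p < fst p \<and> fst p \<le> b}"
    by (auto simp: triangle_def space_pair_measure)
  also have "\<dots> \<in> sets borel"
    unfolding borel_prod[symmetric] by measurable
  finally have "(\<lambda>p. indicator (triangle a b) p *\<^sub>R (case_prod ker) p) \<in> borel_measurable borel"
    by (rule borel_measurable_continuous_on_indicator) (rule continuous_on_ker)
  moreover have "(\<lambda>p. indicator (triangle a b) p *\<^sub>R (case_prod ker) p) = case_prod ker"
    by (auto simp: rl_ker_def fun_eq_iff indicator_def)
  ultimately show ?thesis
    by (simp add: borel_prod)
qed

text \<open>The majorant depends on t - s alone, so translation preserves its integral and one
  \<open>w\<close> serves all t and s. By compactness the order has a maximum m < 1, which makes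
  r^(-m) integrable at 0.\<close>

lemma ker_bound:
  obtains w where "integrable lborel w" "\<And>t s. \<bar>ker t s\<bar> \<le> w (t - s)" 
proof -
  have comp: "compact ({a..b} \<times> {a..b})" by (intro compact_Times) auto
  obtain q where q: "q \<in> {a..b} \<times> {a..b}"
      "\<And>p. p \<in> {a..b} \<times> {a..b} \<Longrightarrow> \<delta> (fst p) (snd p) \<le> \<delta> (fst q) (snd q)"
    using continuous_attains_sup[OF comp _ cont] ab by (auto simp: case_prod_beta)
  define m where "m = \<delta> (fst q) (snd q)"
  have m: "m < 1" "0 \<le> m" using q range[of "fst q" "snd q"] by (auto simp: m_def)
  \<comment> \<open>The reciprocal Gamma function is entire, so this bound needs no distance from
    the poles.\<close>
  have "continuous_on ({a..b} \<times> {a..b}) (\<lambda>p. rGamma (1 - \<delta> (fst p) (snd p)))"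
    by (rule continuous_on_compose2[OF continuous_on_rGamma[of UNIV]])
      (use cont in \<open>auto intro!: continuous_intros simp: case_prod_beta\<close>)
  then have "bounded ((\<lambda>p. rGamma (1 - \<delta> (fst p) (snd p))) ` ({a..b} \<times> {a..b}))"
    using comp compact_continuous_image compact_imp_bounded by blast
  then obtain C where "\<And>y. y \<in> (\<lambda>p. rGamma (1 - \<delta> (fst p) (snd p))) ` ({a..b} \<times> {a..b}) \<Longrightarrow> norm y \<le> C"
    unfolding bounded_iff by blast
  then have C: "\<And>p. p \<in> {a..b} \<times> {a..b} \<Longrightarrow> \<bar>rGamma (1 - \<delta> (fst p) (snd p))\<bar> \<le> C"
    unfolding real_norm_def by blast
  define w where "w r = C * (1 + b - a) * (indicator {0..b - a} r * r powr (- m))" for r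
  have C0: "0 \<le> C" using C[of "(a, a)"] ab by auto
  show ?thesis
  proof
    show "integrable lborel w"
      unfolding w_def by (intro integrable_mult_right integrable_powr_cutoff m) (use ab in auto)
    show "\<bar>ker t s\<bar> \<le> w (t - s)" for t s
    proof (cases "(t, s) \<in> triangle a b")
      case True
      then have ts: "a \<le> s" "s < t" "t \<le> b" by (auto simp: triangle_def)
      have d: "\<delta> t s \<le> m" "0 \<le> \<delta> t s" using q(2)[of "(t, s)"] range[of t s] ts by (auto simp: m_def)
      \<comment> \<open>The excess exponent m - \<delta> lies in [0, 1]. Enlarging its base to 1 + b
        - a, which is at least 1, bounds that power by 1 + b - a.\<close>
      have "(t - s) powr (- \<delta> t s) = (t - s) powr (- m) * (t - s) powr (m - \<delta> t s)"
        by (simp flip: powr_add)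
      also have "(t - s) powr (m - \<delta> t s) \<le> (1 + b - a) powr (m - \<delta> t s)"
        by (rule powr_mono2) (use ts d in auto)
      also have "\<dots> \<le> (1 + b - a) powr 1"
        by (rule powr_mono) (use ab d m in auto)
      finally have 1: "(t - s) powr (- \<delta> t s) \<le> (t - s) powr (- m) * (1 + b - a)"
        using ab by (simp add: mult_left_mono)
      have 2: "\<bar>rGamma (1 - \<delta> t s)\<bar> \<le> C" using C[of "(t, s)"] ts by auto
      have "\<bar>ker t s\<bar> = (t - s) powr (- \<delta> t s) * \<bar>rGamma (1 - \<delta> t s)\<bar>"
        using True by (simp add: rl_ker_def abs_mult rGamma_inverse_Gamma divide_inverse)
      also have "\<dots> \<le> ((t - s) powr (- m) * (1 + b - a)) * C"
        by (intro mult_mono 1 2) (use ab in auto)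
      finally show ?thesis using ts by (simp add: w_def mult_ac)
    next
      case False
      then show ?thesis using C0 ab by (auto simp: rl_ker_def w_def)
    qed
  qed
qed

text \<open>Continuity of the kernel is relative to the triangle, near whose diagonal it may be
  unbounded; hence the arguments must eventually stay inside.\<close>

lemma ker_tendsto:
  assumes "p \<in> triangle a b" "(f \<longlongrightarrow> fst p) F" "(g \<longlongrightarrow> snd p) F"
    "eventually (\<lambda>x. (f x, g x) \<in> triangle a b) F"
  shows "((\<lambda>x. ker (f x) (g x)) \<longlongrightarrow> ker (fst p) (snd p)) F"
proof -
  have "((\<lambda>x. (f x, g x)) \<longlongrightarrow> p) F"
    using tendsto_Pair[OF assms(2,3)] by simp
  from continuous_on_tendsto_compose[OF continuous_on_ker this assms(1,4)]
  show ?thesis by (simp add: case_prod_beta)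
qed

lemma integrable_ker_left:
  assumes [measurable]: "f \<in> borel_measurable borel" and f: "\<And>x. \<bar>f x\<bar> \<le> M"
  shows "integrable lborel (\<lambda>s. ker t s * f s)"
proof -
  obtain w where w: "integrable lborel w" "\<And>t s. \<bar>ker t s\<bar> \<le> w (t - s)"
    using ker_bound by metis
  have "\<bar>ker t s * f s\<bar> \<le> w (t - s) * M" for s
    unfolding abs_mult by (intro mult_mono w f order_trans[OF abs_ge_zero w(2)]) auto
  then show ?thesis
    by (intro Bochner_Integration.integrable_bound[OF integrable_mult_left[OF integrable_translate(1)[OF w(1), of t], of M]])
      (auto intro: order_trans[OF _ abs_ge_self])
qed

lemma integrable_ker_right:
  assumes [measurable]: "f \<in> borel_measurable borel" and f: "\<And>x. \<bar>f x\<bar> \<le> M"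
  shows "integrable lborel (\<lambda>t. ker t s * f t)"
proof -
  obtain w where w: "integrable lborel w" "\<And>t s. \<bar>ker t s\<bar> \<le> w (t - s)"
    using ker_bound by metis
  have "\<bar>ker t s * f t\<bar> \<le> w (t - s) * M" for t
    unfolding abs_mult by (intro mult_mono w f order_trans[OF abs_ge_zero w(2)]) auto
  then show ?thesis
    by (intro Bochner_Integration.integrable_bound[OF integrable_mult_left[OF integrable_translate(2)[OF w(1), of s], of M]])
      (auto intro: order_trans[OF _ abs_ge_self])
qed

text \<open>Integrating the absolute value over s first costs the total mass of \<open>w\<close> and
  leaves the majorant of \<open>g\<close>, which must then be integrable. This is why
  \<open>g\<close> is dominated by an indicator while \<open>f\<close> is only bounded.\<close>

lemma Fubini_ker:
  assumes [measurable]: "f \<in> borel_measurable borel" "g \<in> borel_measurable borel"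
    and f: "\<And>x. \<bar>f x\<bar> \<le> M" and g: "\<And>x. \<bar>g x\<bar> \<le> indicator {c..d} x * N"
  shows "(\<integral>t. g t * left_op a b \<delta> f t \<partial>lborel) = (\<integral>s. f s * right_op a b \<delta> g s \<partial>lborel)"
proof -
  obtain w where w: "integrable lborel w" "\<And>t s. \<bar>ker t s\<bar> \<le> w (t - s)"
    using ker_bound by metis
  define W where "W = (\<integral>s. w s \<partial>lborel)"
  have w0: "0 \<le> w r" for r
    using order_trans[OF abs_ge_zero w(2)[of r 0]] by simp
  have M: "0 \<le> M" using order_trans[OF abs_ge_zero f] by blast
  define h where "h = (\<lambda>t s. ker t s * (f s * g t))"
  have i: "integrable lborel (\<lambda>s. h t s)" for t
    using integrable_mult_left[OF integrable_ker_left[of f M t], of "g t"] f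
    by (simp add: h_def mult_ac)
  have hm[measurable]: "case_prod h \<in> borel_measurable (lborel \<Otimes>\<^sub>M lborel)"
    unfolding h_def by measurable
  have b1: "\<bar>\<integral>s. \<bar>h t s\<bar> \<partial>lborel\<bar> \<le> W * M * (indicator {c..d} t * N)" for t
  proof -
    have "\<bar>\<integral>s. \<bar>h t s\<bar> \<partial>lborel\<bar> = (\<integral>s. \<bar>h t s\<bar> \<partial>lborel)" by simp
    also have "\<dots> \<le> (\<integral>s. w (t - s) * (M * (indicator {c..d} t * N)) \<partial>lborel)"
    proof (rule integral_mono)
      show "integrable lborel (\<lambda>s. \<bar>h t s\<bar>)" using i by auto
      show "integrable lborel (\<lambda>s. w (t - s) * (M * (indicat_real {c..d} t * N)))"
        by (intro integrable_mult_left integrable_translate w)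
      show "\<bar>h t s\<bar> \<le> w (t - s) * (M * (indicat_real {c..d} t * N))" for s
        unfolding h_def abs_mult
        by (intro mult_mono w f g w0 M mult_nonneg_nonneg) auto
    qed
    also have "\<dots> = W * M * (indicator {c..d} t * N)"
      by (simp add: integrable_translate[OF w(1)] W_def)
    finally show ?thesis .
  qed
  have b2: "integrable lborel (\<lambda>t. \<integral>s. norm (case_prod h (t, s)) \<partial>lborel)"
  proof (rule Bochner_Integration.integrable_bound)
    show "integrable lborel (\<lambda>t. W * M * (indicat_real {c..d} t * N))"
      by (intro integrable_mult_right integrable_mult_left) (rule integrable_real_indicator, auto simp: emeasure_lborel_Icc_eq)
    show "AE t in lborel. norm (\<integral>s. norm (case_prod h (t, s)) \<partial>lborel) \<le> norm (W * M * (indicat_real {c..d} t * N))"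
      by (rule AE_I2) (simp, rule order_trans[OF _ abs_ge_self], use b1 in simp)
  qed measurable
  have int: "integrable (lborel \<Otimes>\<^sub>M lborel) (case_prod h)"
    by (rule lborel_pair.Fubini_integrable[OF hm b2]) (use i in auto)
  have "(\<integral>t. g t * left_op a b \<delta> f t \<partial>lborel) = (\<integral>t. (\<integral>s. h t s \<partial>lborel) \<partial>lborel)"
    unfolding left_op_def h_def by (intro Bochner_Integration.integral_cong refl, subst integral_mult_right_zero[symmetric]) (simp add: mult_ac)
  also have "\<dots> = (\<integral>s. (\<integral>t. h t s \<partial>lborel) \<partial>lborel)"
    by (rule lborel_pair.Fubini_integral[OF int, symmetric])
  also have "\<dots> = (\<integral>s. f s * right_op a b \<delta> g s \<partial>lborel)"
    unfolding right_op_def h_def by (intro Bochner_Integration.integral_cong refl, subst integral_mult_right_zero[symmetric]) (simp add: mult_ac)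
  finally show ?thesis .
qed

text \<open>The substitution s = t - r fixes the singularity at r = 0, so that the single majorant
  \<open>w r * M\<close> works for every t.\<close>

lemma continuous_on_left_op:
  assumes [measurable]: "f \<in> borel_measurable borel" and f: "\<And>x. \<bar>f x\<bar> \<le> M"
    and N: "countable N" "\<And>x. x \<notin> N \<Longrightarrow> isCont f x"
  shows "continuous_on {a..b} (left_op a b \<delta> f)"
proof -
  obtain w where w: "integrable lborel w" "\<And>t s. \<bar>ker t s\<bar> \<le> w (t - s)"
    using ker_bound by metis
  define H where "H t r = ker t (t - r) * f (t - r)" for t r
  have "continuous_on {a..b} (\<lambda>t. \<integral>r. H t r \<partial>lborel)"
  proof (rule continuous_on_integral_dominated)
    show "integrable lborel (\<lambda>r. w r * M)" using w by auto
    show "H t \<in> borel_measurable lborel" for t unfolding H_def by measurable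
    show "\<bar>H t r\<bar> \<le> w r * M" for t r
      unfolding abs_mult H_def
      using w(2)[of t "t - r"] by (intro mult_mono f order_trans[OF abs_ge_zero w(2)[of r 0, simplified]]) auto
    fix t assume t: "t \<in> {a..b}"
    \<comment> \<open>Excluded are the singularity r = 0, the value at which t - r reaches the left
      end \<open>a\<close>, and those at which t - r hits a discontinuity of \<open>f\<close>.
      Elsewhere the integrand either vanishes near t or is continuous there.\<close>
    have "countable ({0, t - a} \<union> (\<lambda>x. t - x) ` N)" using N by auto
    then have "AE r in lborel. r \<notin> {0, t - a} \<union> (\<lambda>x. t - x) ` N"
      by (intro AE_not_in countable_imp_null_set_lborel)
    then show "AE r in lborel. ((\<lambda>s. H s r) \<longlongrightarrow> H t r) (at t within {a..b})"
    proof eventually_elim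
      case (elim r)
      have tr: "((\<lambda>s. s - r) \<longlongrightarrow> t - r) (at t within {a..b})" by (intro tendsto_intros)
      consider "r < 0" | "r > t - a" | "0 < r" "r < t - a" using elim by force
      then show ?case
      proof cases
        case 1
        then show ?thesis by (simp add: H_def rl_ker_def triangle_def)
      next
        case 2
        then have "\<forall>\<^sub>F s in at t within {a..b}. s - r < a"
          by (intro order_tendstoD(2)[OF tr]) auto
        then have "\<forall>\<^sub>F s in at t within {a..b}. H s r = 0"
          by eventually_elim (auto simp: H_def rl_ker_def triangle_def)
        moreover have "H t r = 0" using 2 by (simp add: H_def rl_ker_def triangle_def)
        ultimately show ?thesis by (simp add: tendsto_eventually)
      next
        case 3
        have "\<forall>\<^sub>F s in at t within {a..b}. a < s - r"
          using 3 by (intro order_tendstoD(1)[OF tr]) auto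
        moreover have "\<forall>\<^sub>F s in at t within {a..b}. s \<in> {a..b}"
          by (simp add: eventually_at_filter)
        ultimately have ev: "\<forall>\<^sub>F s in at t within {a..b}. (s, s - r) \<in> triangle a b"
          by eventually_elim (use 3 in \<open>auto simp: triangle_def\<close>)
        have "isCont f (t - r)" using elim by (intro N) (auto simp: image_iff)
        then have "((\<lambda>s. f (s - r)) \<longlongrightarrow> f (t - r)) (at t within {a..b})"
          using tr by (rule isCont_tendsto_compose)
        moreover have "((\<lambda>s. ker s (s - r)) \<longlongrightarrow> ker t (t - r)) (at t within {a..b})"
          using ker_tendsto[of "(t, t - r)", OF _ _ _ ev] t 3 tr by (auto simp: triangle_def tendsto_ident_at)
        ultimately show ?thesis unfolding H_def by (intro tendsto_intros)
      qed
    qed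
  qed
  moreover have "(\<integral>r. H t r \<partial>lborel) = left_op a b \<delta> f t" for t
    unfolding H_def left_op_def using lborel_integral_real_affine[of "-1" "\<lambda>s. ker t s * f s" t] by simp
  ultimately show ?thesis by simp
qed

text \<open>Mirror image of \<open>continuous_on_left_op\<close>: the substitution is t = s + r, and
  the right end \<open>b\<close> takes the place of \<open>a\<close>.\<close>

lemma continuous_on_right_op:
  assumes [measurable]: "f \<in> borel_measurable borel" and f: "\<And>x. \<bar>f x\<bar> \<le> M"
    and N: "countable N" "\<And>x. x \<notin> N \<Longrightarrow> isCont f x"
  shows "continuous_on {a..b} (right_op a b \<delta> f)"
proof -
  obtain w where w: "integrable lborel w" "\<And>t s. \<bar>ker t s\<bar> \<le> w (t - s)"
    using ker_bound by metis
  define H where "H s r = ker (s + r) s * f (s + r)" for s r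
  have "continuous_on {a..b} (\<lambda>s. \<integral>r. H s r \<partial>lborel)"
  proof (rule continuous_on_integral_dominated)
    show "integrable lborel (\<lambda>r. w r * M)" using w by auto
    show "H t \<in> borel_measurable lborel" for t unfolding H_def by measurable
    show "\<bar>H s r\<bar> \<le> w r * M" for s r
      unfolding abs_mult H_def
      using w(2)[of "s + r" s] by (intro mult_mono f order_trans[OF abs_ge_zero w(2)[of r 0, simplified]]) auto
    fix t assume t: "t \<in> {a..b}"
    have "countable ({0, b - t} \<union> (\<lambda>x. x - t) ` N)" using N by auto
    then have "AE r in lborel. r \<notin> {0, b - t} \<union> (\<lambda>x. x - t) ` N"
      by (intro AE_not_in countable_imp_null_set_lborel)
    then show "AE r in lborel. ((\<lambda>s. H s r) \<longlongrightarrow> H t r) (at t within {a..b})"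
    proof eventually_elim
      case (elim r)
      have tr: "((\<lambda>s. s + r) \<longlongrightarrow> t + r) (at t within {a..b})" by (intro tendsto_intros)
      consider "r < 0" | "r > b - t" | "0 < r" "r < b - t" using elim by force
      then show ?case
      proof cases
        case 1
        then show ?thesis by (simp add: H_def rl_ker_def triangle_def)
      next
        case 2
        then have "\<forall>\<^sub>F s in at t within {a..b}. b < s + r"
          by (intro order_tendstoD(1)[OF tr]) auto
        then have "\<forall>\<^sub>F s in at t within {a..b}. H s r = 0"
          by eventually_elim (auto simp: H_def rl_ker_def triangle_def)
        moreover have "H t r = 0" using 2 by (simp add: H_def rl_ker_def triangle_def)
        ultimately show ?thesis by (simp add: tendsto_eventually)
      next
        case 3
        have "\<forall>\<^sub>F s in at t within {a..b}. s + r < b"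
          using 3 by (intro order_tendstoD(2)[OF tr]) auto
        moreover have "\<forall>\<^sub>F s in at t within {a..b}. s \<in> {a..b}"
          by (simp add: eventually_at_filter)
        ultimately have ev: "\<forall>\<^sub>F s in at t within {a..b}. (s + r, s) \<in> triangle a b"
          by eventually_elim (use 3 in \<open>auto simp: triangle_def\<close>)
        have "t + r \<notin> N" using elim by force
        then have "isCont f (t + r)" by (rule N)
        then have "((\<lambda>s. f (s + r)) \<longlongrightarrow> f (t + r)) (at t within {a..b})"
          using tr by (rule isCont_tendsto_compose)
        moreover have "((\<lambda>s. ker (s + r) s) \<longlongrightarrow> ker (t + r) t) (at t within {a..b})"
          using ker_tendsto[of "(t + r, t)", OF _ _ _ ev] t 3 tr by (auto simp: triangle_def tendsto_ident_at)
        ultimately show ?thesis unfolding H_def by (intro tendsto_intros)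
      qed
    qed
  qed
  moreover have "(\<integral>r. H t r \<partial>lborel) = right_op a b \<delta> f t" for t
    unfolding H_def right_op_def using lborel_integral_real_affine[of "1" "\<lambda>s. ker s t * f s" t] by simp
  ultimately show ?thesis by simp
qed

end

section \<open>Functions cut off to an interval\<close>

lemma cutoff_cong: "(\<And>s. s \<in> {c..d} \<Longrightarrow> f s = g s) \<Longrightarrow> cutoff c d f = cutoff c d g"
  by (auto simp: cutoff_def indicator_def fun_eq_iff)

lemma measurable_cutoff: "continuous_on {c..d} f \<Longrightarrow> cutoff c d f \<in> borel_measurable borel"
  using borel_measurable_continuous_on_indicator[of "{c..d}" f] unfolding cutoff_def by simp

lemma cutoff_bounded:
  assumes "continuous_on {c..d} f"
  obtains M where "0 \<le> M" "\<And>x. \<bar>cutoff c d f x\<bar> \<le> indicator {c..d} x * M" "\<And>x. \<bar>cutoff c d f x\<bar> \<le> M"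
proof -
  have "bounded (f ` {c..d})"
    using assms compact_continuous_image compact_imp_bounded by blast
  then obtain M where "\<And>y. y \<in> f ` {c..d} \<Longrightarrow> norm y \<le> M"
    unfolding bounded_iff by blast
  then have "\<And>x. x \<in> {c..d} \<Longrightarrow> \<bar>f x\<bar> \<le> M" by auto
  then show thesis
    by (intro that[of "max M 0"]) (auto simp: cutoff_def indicator_def le_max_iff_disj)
qed

lemma isCont_cutoff:
  assumes "continuous_on {c..d} f" "x \<notin> {c, d}"
  shows "isCont (cutoff c d f) x"
proof (cases "x \<in> {c<..<d}")
  case True
  have "continuous_on {c<..<d} (cutoff c d f)"
    by (rule continuous_on_eq[OF continuous_on_subset[OF assms(1)]]) (auto simp: cutoff_def)
  then show ?thesis using True by (simp add: continuous_on_eq_continuous_at)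
next
  case False
  then have "x \<in> - {c..d}" using assms by auto
  moreover have "continuous_on (- {c..d}) (cutoff c d f)"
    by (rule continuous_on_eq[OF continuous_on_const[of _ 0]]) (auto simp: cutoff_def)
  ultimately show ?thesis
    by (subst (asm) continuous_on_eq_continuous_at) (auto simp: open_Compl)
qed

lemma cutoff_integral:
  assumes "continuous_on {c..d} f"
  shows "integrable lborel (cutoff c d f)" "integral {c..d} f = (\<integral>x. cutoff c d f x \<partial>lborel)"
    "(LBINT x:{c..d}. f x) = integral {c..d} f"
  using borel_integrable_atLeastAtMost'[OF assms] set_borel_integral_eq_integral(2)[of "{c..d}" f]
  unfolding set_integrable_def set_lebesgue_integral_def cutoff_def by auto

lemma cutoff_integral_mult:
  assumes "continuous_on {c..d} f" "continuous_on {c..d} g"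
  shows "integrable lborel (\<lambda>x. cutoff c d f x * g x)"
    "integral {c..d} (\<lambda>x. f x * g x) = (\<integral>x. cutoff c d f x * g x \<partial>lborel)"
proof -
  have "cutoff c d (\<lambda>x. f x * g x) = (\<lambda>x. cutoff c d f x * g x)" by (simp add: cutoff_def fun_eq_iff)
  then show "integrable lborel (\<lambda>x. cutoff c d f x * g x)"
    "integral {c..d} (\<lambda>x. f x * g x) = (\<integral>x. cutoff c d f x * g x \<partial>lborel)"
    using cutoff_integral[OF continuous_on_mult[OF assms]] by auto
qed

section \<open>Riemann-Liouville integrals as operators, and their transposition\<close>

context variable_order
begin

text \<open>The diagonal needs no care, since \<open>0 powr y\<close> is 0 and so is the kernel
  there. As the kernel also vanishes for s beyond t, every cutoff end \<open>d\<close> with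
  \<open>t \<le> d\<close> gives the same value, and one cutoff function serves all t up to
  \<open>d\<close>.\<close>

lemma RL_left_eq_left_op:
  assumes "a \<le> c" "t \<le> d" "t \<le> b"
  shows "RL_left_int \<delta> c f t = left_op a b \<delta> (cutoff c d f) t"
  unfolding RL_left_int_def left_op_def set_lebesgue_integral_def
  using assms
  by (intro Bochner_Integration.integral_cong) (auto simp: rl_ker_def triangle_def cutoff_def indicator_def)

lemma RL_right_eq_right_op:
  assumes "a \<le> s" "d \<le> s" "c \<le> b"
  shows "RL_right_int \<delta> c f s = right_op a b \<delta> (cutoff d c f) s"
  unfolding RL_right_int_def right_op_def set_lebesgue_integral_def
  using assms
  by (intro Bochner_Integration.integral_cong) (auto simp: rl_ker_def triangle_def cutoff_def indicator_def)

lemma continuous_on_left_op_cutoff: "continuous_on {c..d} f \<Longrightarrow> continuous_on {a..b} (left_op a b \<delta> (cutoff c d f))"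
  using cutoff_bounded[of c d f] continuous_on_left_op[OF measurable_cutoff, of c d f _ "{c,d}"] isCont_cutoff[of c d f]
  by (metis countable_insert countable_empty)

lemma continuous_on_right_op_cutoff: "continuous_on {c..d} f \<Longrightarrow> continuous_on {a..b} (right_op a b \<delta> (cutoff c d f))"
  using cutoff_bounded[of c d f] continuous_on_right_op[OF measurable_cutoff, of c d f _ "{c,d}"] isCont_cutoff[of c d f]
  by (metis countable_insert countable_empty)

lemma left_op_linear:
  assumes f: "continuous_on {c..d} f" and g: "continuous_on {c..d} g"
  shows "left_op a b \<delta> (cutoff c d (\<lambda>x. f x + k * g x)) t = left_op a b \<delta> (cutoff c d f) t + k * left_op a b \<delta> (cutoff c d g) t"
proof -
  obtain M M' where M: "\<And>x. \<bar>cutoff c d f x\<bar> \<le> M" "\<And>x. \<bar>cutoff c d g x\<bar> \<le> M'"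
    using cutoff_bounded[OF f] cutoff_bounded[OF g] by metis
  have "ker t s * cutoff c d (\<lambda>x. f x + k * g x) s = ker t s * cutoff c d f s + k * (ker t s * cutoff c d g s)" for s
    by (simp add: cutoff_def algebra_simps)
  then show ?thesis
    using integrable_ker_left[OF measurable_cutoff[OF f] M(1)] integrable_ker_left[OF measurable_cutoff[OF g] M(2)]
    unfolding left_op_def by simp
qed

lemma right_op_linear:
  assumes f: "continuous_on {c..d} f" and g: "continuous_on {c..d} g"
  shows "right_op a b \<delta> (cutoff c d (\<lambda>x. f x + k * g x)) t = right_op a b \<delta> (cutoff c d f) t + k * right_op a b \<delta> (cutoff c d g) t"
proof -
  obtain M M' where M: "\<And>x. \<bar>cutoff c d f x\<bar> \<le> M" "\<And>x. \<bar>cutoff c d g x\<bar> \<le> M'"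
    using cutoff_bounded[OF f] cutoff_bounded[OF g] by metis
  have "ker s t * cutoff c d (\<lambda>x. f x + k * g x) s = ker s t * cutoff c d f s + k * (ker s t * cutoff c d g s)" for s
    by (simp add: cutoff_def algebra_simps)
  then show ?thesis
    using integrable_ker_right[OF measurable_cutoff[OF f] M(1)] integrable_ker_right[OF measurable_cutoff[OF g] M(2)]
    unfolding right_op_def by simp
qed

text \<open>Fractional integration by parts without boundary terms: Fubini for two cut-off
  functions, where the restriction to [a, T] has become the cutoff of \<open>p\<close>.\<close>

lemma integral_mult_left_op:
  assumes e: "continuous_on {a..b} e" and p: "continuous_on {a..T} p" and T: "T \<le> b"
  shows "integral {a..T} (\<lambda>t. p t * left_op a b \<delta> (cutoff a b e) t) =
         integral {a..b} (\<lambda>s. e s * right_op a b \<delta> (cutoff a T p) s)"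
proof -
  obtain M where M: "\<And>x. \<bar>cutoff a b e x\<bar> \<le> M" using cutoff_bounded[OF e] by metis
  obtain N where N: "\<And>x. \<bar>cutoff a T p x\<bar> \<le> indicator {a..T} x * N" using cutoff_bounded[OF p] by metis
  have "continuous_on {a..T} (left_op a b \<delta> (cutoff a b e))"
    by (rule continuous_on_subset[OF continuous_on_left_op_cutoff[OF e]]) (use T in auto)
  with Fubini_ker[OF measurable_cutoff[OF e] measurable_cutoff[OF p] M N]
  show ?thesis by (simp add: cutoff_integral_mult p e continuous_on_right_op_cutoff)
qed

text \<open>At t < T the right operator sees \<open>e\<close> on all of [t, b]. Transposed, the left
  operator carries the values of \<open>p\<close> on [a, T] to points beyond T; this is the origin
  of the third transversality condition.\<close>

lemma integral_mult_right_op: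
  assumes e: "continuous_on {a..b} e" and p: "continuous_on {a..T} p" and T: "T \<le> b"
  shows "integral {a..T} (\<lambda>t. p t * right_op a b \<delta> (cutoff a b e) t) =
         integral {a..b} (\<lambda>s. e s * left_op a b \<delta> (cutoff a T p) s)"
proof -
  obtain M where M: "\<And>x. \<bar>cutoff a T p x\<bar> \<le> M" using cutoff_bounded[OF p] by metis
  obtain N where N: "\<And>x. \<bar>cutoff a b e x\<bar> \<le> indicator {a..b} x * N" using cutoff_bounded[OF e] by metis
  have "continuous_on {a..T} (right_op a b \<delta> (cutoff a b e))"
    by (rule continuous_on_subset[OF continuous_on_right_op_cutoff[OF e]]) (use T in auto)
  with Fubini_ker[OF measurable_cutoff[OF p] measurable_cutoff[OF e] M N]
  show ?thesis by (simp add: cutoff_integral_mult p e continuous_on_left_op_cutoff)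
qed

end

section \<open>Order zero, degenerate ranges, and the memory of [a, T]\<close>

lemma rl_ker_zero: "rl_ker a b (\<lambda>_ _. 0) t s = indicator (triangle a b) (t, s)"
  by (auto simp: rl_ker_def triangle_def indicator_def)

lemma variable_order_zero: "a < b \<Longrightarrow> variable_order a b (\<lambda>_ _. 0)"
  by unfold_locales auto

lemma left_op_zero:
  assumes "a < b" "continuous_on {a..b} e" "t \<in> {a..b}"
  shows "left_op a b (\<lambda>_ _. 0) (cutoff a b e) t = integral {a..t} e"
proof -
  interpret variable_order a b "\<lambda>_ _. 0" using assms by (intro variable_order_zero)
  have "left_op a b (\<lambda>_ _. 0) (cutoff a b e) t = (\<integral>s. cutoff a t e s \<partial>lborel)"
    unfolding left_op_def
  proof (rule integral_cong_AE)
    \<comment> \<open>The two sides can differ only at s = t: the triangle excludes the diagonal,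
      the closed interval includes it.\<close>
    show "AE s in lborel. rl_ker a b (\<lambda>_ _. 0) t s * cutoff a b e s = cutoff a t e s"
      using AE_lborel_singleton[of t]
      by eventually_elim (use assms in \<open>auto simp: rl_ker_zero triangle_def cutoff_def indicator_def\<close>)
    have [measurable]: "cutoff a b e \<in> borel_measurable borel" by (rule measurable_cutoff) fact
    show "(\<lambda>s. rl_ker a b (\<lambda>_ _. 0) t s * cutoff a b e s) \<in> borel_measurable lborel"
      by measurable
    show "cutoff a t e \<in> borel_measurable lborel"
      using measurable_cutoff[OF continuous_on_subset[OF assms(2)], of a t] assms by auto
  qed
  also have "\<dots> = integral {a..t} e"
    by (rule cutoff_integral(2)[symmetric], rule continuous_on_subset[OF assms(2)]) (use assms in auto)
  finally show ?thesis .
qed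

lemma right_op_zero:
  assumes "a < b" "continuous_on {a..T} q" "s \<in> {a..T}" "T \<le> b"
  shows "right_op a b (\<lambda>_ _. 0) (cutoff a T q) s = integral {s..T} q"
proof -
  interpret variable_order a b "\<lambda>_ _. 0" using assms by (intro variable_order_zero)
  have "right_op a b (\<lambda>_ _. 0) (cutoff a T q) s = (\<integral>t. cutoff s T q t \<partial>lborel)"
    unfolding right_op_def
  proof (rule integral_cong_AE)
    show "AE t in lborel. rl_ker a b (\<lambda>_ _. 0) t s * cutoff a T q t = cutoff s T q t"
      using AE_lborel_singleton[of s]
      by eventually_elim (use assms in \<open>auto simp: rl_ker_zero triangle_def cutoff_def indicator_def\<close>)
    have [measurable]: "cutoff a T q \<in> borel_measurable borel" by (rule measurable_cutoff) fact
    show "(\<lambda>t. rl_ker a b (\<lambda>_ _. 0) t s * cutoff a T q t) \<in> borel_measurable lborel"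
      by measurable
    show "cutoff s T q \<in> borel_measurable lborel"
      using measurable_cutoff[OF continuous_on_subset[OF assms(2)], of s T] assms by auto
  qed
  also have "\<dots> = integral {s..T} q"
    by (rule cutoff_integral(2)[symmetric], rule continuous_on_subset[OF assms(2)]) (use assms in auto)
  finally show ?thesis .
qed

lemma right_op_cutoff_beyond: "T \<le> s \<Longrightarrow> right_op a b \<delta> (cutoff a T q) s = 0"
  unfolding right_op_def
  by (rule integral_eq_zero_AE, rule AE_I2) (auto simp: rl_ker_def triangle_def cutoff_def indicator_def)

text \<open>The integrand vanishes even at the single point of the range, because
  \<open>0 powr y\<close> is 0.\<close>

lemma RL_int_self: "RL_left_int \<delta> c f c = 0" "RL_right_int \<delta> c f c = 0"
proof -
  have "(\<lambda>\<tau>. indicator {c..c} \<tau> *\<^sub>R ((c - \<tau>) powr (- \<delta> c \<tau>) / Gamma (1 - \<delta> c \<tau>) * f \<tau>)) = (\<lambda>_. 0)"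
    "(\<lambda>\<tau>. indicator {c..c} \<tau> *\<^sub>R ((\<tau> - c) powr (- \<delta> \<tau> c) / Gamma (1 - \<delta> \<tau> c) * f \<tau>)) = (\<lambda>_. 0)"
    by (auto simp: indicator_def)
  then show "RL_left_int \<delta> c f c = 0" "RL_right_int \<delta> c f c = 0"
    unfolding RL_left_int_def RL_right_int_def set_lebesgue_integral_def by simp_all
qed

text \<open>Removing the integral based at T from the one based at a leaves the memory of [a, T].
  The two pieces of \<open>p\<close> overlap at T only, a null set.\<close>

lemma (in variable_order) RL_left_diff_eq_left_op:
  assumes p: "continuous_on {a..b} p" and T: "a \<le> T" "T \<le> t" "t \<le> b"
  shows "RL_left_int \<delta> a p t - RL_left_int \<delta> T p t = left_op a b \<delta> (cutoff a T p) t"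
proof -
  have p1: "continuous_on {a..T} p" and p2: "continuous_on {T..b} p"
    using T by (auto intro: continuous_on_subset[OF p])
  note m[measurable] = measurable_cutoff[OF p1] measurable_cutoff[OF p2] measurable_cutoff[OF p]
  obtain M1 where M1: "\<And>x. \<bar>cutoff a T p x\<bar> \<le> M1" using cutoff_bounded[OF p1] by metis
  obtain M2 where M2: "\<And>x. \<bar>cutoff T b p x\<bar> \<le> M2" using cutoff_bounded[OF p2] by metis
  have "left_op a b \<delta> (cutoff a b p) t = (\<integral>s. ker t s * cutoff a T p s + ker t s * cutoff T b p s \<partial>lborel)"
    unfolding left_op_def
  proof (rule integral_cong_AE)
    show "AE s in lborel. ker t s * cutoff a b p s = ker t s * cutoff a T p s + ker t s * cutoff T b p s"
      using AE_lborel_singleton[of T]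
      by eventually_elim (use T in \<open>auto simp: cutoff_def indicator_def\<close>)
  qed measurable
  also have "\<dots> = left_op a b \<delta> (cutoff a T p) t + left_op a b \<delta> (cutoff T b p) t"
    unfolding left_op_def
    by (intro Bochner_Integration.integral_add integrable_ker_left[OF m(1) M1] integrable_ker_left[OF m(2) M2])
  finally show ?thesis
    using T by (simp add: RL_left_eq_left_op[of _ t b])
qed

subsection \<open>Fundamental lemma and multiplier rule\<close>

lemma du_Bois_Reymond_jump:
  fixes V :: "real \<Rightarrow> real"
  assumes T: "a < T" "T < b" and V: "continuous_on {a..b} V"
    and zero: "\<And>e. continuous_on {a..b} e \<Longrightarrow>
      integral {a..b} (\<lambda>s. e s * V s) + c * integral {a..T} e = 0"
  shows "c = 0" "\<And>s. s \<in> {a..b} \<Longrightarrow> V s = 0"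
proof -
  text \<open>The test function vanishes at \<open>T\<close>, hence is continuous, and makes both integrands nonnegative.\<close>
  define e where "e s = (if s \<le> T then (V s + c) * (T - s) else V s * (s - T))" for s
  have V1: "continuous_on {a..T} V" and V2: "continuous_on {T..b} V"
    using T by (auto intro: continuous_on_subset[OF V])
  have e: "continuous_on {a..b} e"
  proof -
    have "continuous_on ({a..T} \<union> {T..b}) e"
      unfolding e_def by (rule continuous_on_If) (auto intro!: continuous_intros V1 V2)
    then show ?thesis using T by (simp add: ivl_disj_un_two_touch)
  qed
  have e1: "continuous_on {a..T} e" and e2: "continuous_on {T..b} e"
    using T by (auto intro: continuous_on_subset[OF e])
  have i1: "continuous_on {a..T} (\<lambda>s. e s * (V s + c))" and i2: "continuous_on {T..b} (\<lambda>s. e s * V s)"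
    by (intro continuous_intros e1 e2 V1 V2)+
  have "integral {a..b} (\<lambda>s. e s * V s) = integral {a..T} (\<lambda>s. e s * V s) + integral {T..b} (\<lambda>s. e s * V s)"
    by (rule Henstock_Kurzweil_Integration.integral_combine[symmetric])
      (use T in \<open>auto intro!: integrable_continuous_real continuous_intros V e\<close>)
  moreover have "integral {a..T} (\<lambda>s. e s * (V s + c)) = integral {a..T} (\<lambda>s. e s * V s) + c * integral {a..T} e"
    unfolding distrib_left
    by (subst Henstock_Kurzweil_Integration.integral_add)
      (auto intro!: integrable_continuous_real continuous_intros V1 e1 simp: mult.commute[of _ c])
  ultimately have sum: "integral {a..T} (\<lambda>s. e s * (V s + c)) + integral {T..b} (\<lambda>s. e s * V s) = 0"
    using zero[OF e] by simp
  have n1: "e s * (V s + c) \<ge> 0" if "s \<in> {a..T}" for s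
    using that mult_nonneg_nonneg[of "(V s + c)\<^sup>2" "T - s"] by (simp add: e_def power2_eq_square mult_ac)
  have eT: "e T = 0" by (simp add: e_def)
  have n2: "e s * V s \<ge> 0" if "s \<in> {T..b}" for s
    using that mult_nonneg_nonneg[of "(V s)\<^sup>2" "s - T"] eT
    by (cases "s = T") (auto simp: e_def power2_eq_square mult_ac)
  have "integral {a..T} (\<lambda>s. e s * (V s + c)) \<ge> 0" "integral {T..b} (\<lambda>s. e s * V s) \<ge> 0"
    using n1 n2 i1 i2 by (auto intro!: integral_nonneg integrable_continuous_real)
  with sum have z: "integral {a..T} (\<lambda>s. e s * (V s + c)) = 0" "integral {T..b} (\<lambda>s. e s * V s) = 0"
    by auto
  have z1: "e s * (V s + c) = 0" if "s \<in> {a..T}" for s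
    using integral_eq_0_iff[OF i1 T(1)] n1 z that by blast
  have z2: "e s * V s = 0" if "s \<in> {T..b}" for s
    using integral_eq_0_iff[OF i2 T(2)] n2 z that by blast
  have l: "V s + c = 0" if "s \<in> {a..<T}" for s
    using z1[of s] that by (auto simp: e_def)
  have r: "V s = 0" if "s \<in> {T<..b}" for s
    using z2[of s] that by (auto simp: e_def)
  \<comment> \<open>At T the weight in \<open>e\<close> vanishes and yields no information. The
    value is recovered from either side by continuity, and the two results are compatible only for c
    = 0.\<close>
  have lT: "V T + c = 0"
  proof (rule continuous_constant_on_closure[of "{a..<T}" "\<lambda>s. V s + c"])
    show "continuous_on (closure {a..<T}) (\<lambda>s. V s + c)"
      using T by (auto intro!: continuous_intros V1)
  qed (use T l in auto)
  have rT: "V T = 0"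
  proof (rule continuous_constant_on_closure[of "{T<..b}" V])
    show "continuous_on (closure {T<..b}) V" using T V2 by simp
  qed (use T r in auto)
  show c: "c = 0" using lT rT by simp
  show "V s = 0" if "s \<in> {a..b}" for s
    using l[of s] r[of s] rT c that by (cases s T rule: linorder_cases) auto
qed

lemma bounded_linear_real_prod:
  fixes H :: "real \<times> real \<Rightarrow> real"
  assumes "bounded_linear H"
  shows "H (p, q) = p * H (1, 0) + q * H (0, 1)"
proof -
  interpret H: bounded_linear H by fact
  have "(p, q) = p *\<^sub>R (1, 0) + q *\<^sub>R (0, 1)" by simp
  then have "H (p, q) = H (p *\<^sub>R (1, 0)) + H (q *\<^sub>R (0, 1))" by (simp only: H.add)
  then show ?thesis by (simp only: H.scaleR) simp
qed

text \<open>Only differentiability at the origin and continuity in the second variable are assumed of \<open>G\<close>,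
  because \<open>\<psi>\<close> need not be \<open>C\<^sup>1\<close>; zeros of \<open>G\<close> along \<open>\<epsilon> (\<sigma>, \<sigma> k + y)\<close> with \<open>\<bar>y\<bar> \<le> \<eta>\<close> come from the
  intermediate value theorem instead of the implicit function theorem.\<close>

lemma multiplier_rule:
  fixes J G :: "real \<times> real \<Rightarrow> real"
  assumes J: "(J has_derivative J') (at 0)" and G: "(G has_derivative G') (at 0)"
    and G0: "G 0 = 0" and nz: "G' (0, 1) \<noteq> 0" and r: "r > 0"
    and cont: "\<And>p. continuous_on {q. norm (p, q) < r} (\<lambda>q. G (p, q))"
    and min: "\<And>w. norm w < r \<Longrightarrow> G w = 0 \<Longrightarrow> J 0 \<le> J w"
  shows "J' (1, 0) * G' (0, 1) = J' (0, 1) * G' (1, 0)"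
proof (rule ccontr)
  assume ne: "\<not> ?thesis"
  interpret J: bounded_linear J' using J by (rule has_derivative_bounded_linear)
  interpret G: bounded_linear G' using G by (rule has_derivative_bounded_linear)
  note Jl = bounded_linear_real_prod[OF J.bounded_linear_axioms]
    and Gl = bounded_linear_real_prod[OF G.bounded_linear_axioms]
  \<comment> \<open>(1, k) spans the kernel of \<open>G'\<close>, and \<open>A\<close> is the slope
    of \<open>J\<close> along it; the negated claim says precisely that \<open>A\<close> is not
    0.\<close>
  define k where "k = - G' (1, 0) / G' (0, 1)"
  define A where "A = J' (1, 0) + k * J' (0, 1)"
  have A: "A \<noteq> 0" using ne nz by (simp add: A_def k_def field_simps)
  \<comment> \<open>The sign turns the movement along (1, k) into descent:
    \<open>\<sigma> * A\<close> is -|A|.\<close>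
  define \<sigma> where "\<sigma> = - sgn A"
  define d where "d = J' (0, 1)"
  define g where "g = G' (0, 1)"
  \<comment> \<open>A correction y with |y| at most \<eta> changes the slope of \<open>J\<close> by
    at most |A| / 2; the added 1 guards against d = 0.\<close>
  define \<eta> where "\<eta> = \<bar>A\<bar> / (2 * (\<bar>d\<bar> + 1))"
  have \<eta>: "0 < \<eta>" using A by (simp add: \<eta>_def)
  have \<eta>d: "\<eta> * \<bar>d\<bar> \<le> \<bar>A\<bar> / 2"
  proof -
    have "\<eta> * \<bar>d\<bar> \<le> \<eta> * (\<bar>d\<bar> + 1)" using \<eta> by simp
    also have "\<dots> = \<bar>A\<bar> / 2" by (simp add: \<eta>_def add_pos_nonneg field_simps)
    finally show ?thesis .
  qed
  have Gv: "G' (\<sigma>, \<sigma> * k + y) = y * g" for y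
    using Gl[of \<sigma> "\<sigma> * k + y"] nz by (simp add: k_def g_def field_simps)
  have Jv: "J' (\<sigma>, \<sigma> * k + y) \<le> - \<bar>A\<bar> / 2" if "\<bar>y\<bar> \<le> \<eta>" for y
  proof -
    have "J' (\<sigma>, \<sigma> * k + y) = \<sigma> * A + y * d"
      using Jl[of \<sigma> "\<sigma> * k + y"] by (simp add: A_def d_def algebra_simps)
    moreover have "\<sigma> * A = - \<bar>A\<bar>" by (simp add: \<sigma>_def abs_sgn)
    moreover have "y * d \<le> \<eta> * \<bar>d\<bar>"
      using mult_right_mono[OF that abs_ge_zero[of d]] by (metis abs_le_D1 abs_mult)
    ultimately show ?thesis using \<eta>d by simp
  qed
  define u where "u y = (\<sigma>, \<sigma> * k + y)" for y
  define B where "B = \<bar>\<sigma>\<bar> + (\<bar>\<sigma> * k\<bar> + \<eta>)"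
  have u: "norm (u y) \<le> B" if "\<bar>y\<bar> \<le> \<eta>" for y
    using norm_Pair_le[of \<sigma> "\<sigma> * k + y"] abs_triangle_ineq[of "\<sigma> * k" y] that by (simp add: u_def B_def)
  have B: "0 < B" using \<eta> by (simp add: B_def add_nonneg_pos)
  \<comment> \<open>The remainder of \<open>J\<close> may use up half of the guaranteed descent |A|
    / 2, that of \<open>G\<close> half of its leading coefficient \<eta> |g| at the ends y = \<eta>
    and y = -\<eta>. Both are measured against a step of norm at most \<epsilon> B, whence the
    division by B.\<close>
  define \<kappa> where "\<kappa> = min (\<bar>A\<bar> / 4) (\<eta> * \<bar>g\<bar> / 2) / B"
  have \<kappa>: "0 < \<kappa>" using A nz B \<eta> by (simp add: \<kappa>_def g_def)
  have \<kappa>B: "\<kappa> * B \<le> \<bar>A\<bar> / 4" "\<kappa> * B \<le> \<eta> * \<bar>g\<bar> / 2" using B by (auto simp: \<kappa>_def)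
  obtain s1 where s1: "s1 > 0" "\<And>w. norm w < s1 \<Longrightarrow> norm (J w - J 0 - J' w) \<le> \<kappa> * norm w"
    using J \<kappa> unfolding has_derivative_at_alt by (metis diff_zero)
  obtain s2 where s2: "s2 > 0" "\<And>w. norm w < s2 \<Longrightarrow> norm (G w - G 0 - G' w) \<le> \<kappa> * norm w"
    using G \<kappa> unfolding has_derivative_at_alt by (metis diff_zero)
  define \<epsilon> where "\<epsilon> = min r (min s1 s2) / (2 * B)"
  have \<epsilon>: "0 < \<epsilon>" using r s1 s2 B by (simp add: \<epsilon>_def)
  have "\<epsilon> * B < r" "\<epsilon> * B < s1" "\<epsilon> * B < s2" using r s1 s2 B by (auto simp: \<epsilon>_def min_def)
  moreover have nu: "norm (\<epsilon> *\<^sub>R u y) \<le> \<epsilon> * B" if "\<bar>y\<bar> \<le> \<eta>" for y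
    using u[OF that] \<epsilon> by simp
  ultimately have small: "norm (\<epsilon> *\<^sub>R u y) < r" "norm (\<epsilon> *\<^sub>R u y) < s1" "norm (\<epsilon> *\<^sub>R u y) < s2"
    if "\<bar>y\<bar> \<le> \<eta>" for y using that by (meson le_less_trans)+
  have Ge: "\<bar>G (\<epsilon> *\<^sub>R u y) - \<epsilon> * (y * g)\<bar> \<le> \<epsilon> * (\<eta> * \<bar>g\<bar> / 2)" if "\<bar>y\<bar> \<le> \<eta>" for y
  proof -
    have "\<bar>G (\<epsilon> *\<^sub>R u y) - \<epsilon> * (y * g)\<bar> \<le> \<kappa> * norm (\<epsilon> *\<^sub>R u y)"
      using s2(2)[OF small(3)[OF that]] G0 Gv[of y] by (simp add: G.scaleR u_def del: scaleR_Pair)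
    also have "\<dots> \<le> \<kappa> * (\<epsilon> * B)" using nu[OF that] \<kappa> by (intro mult_left_mono) auto
    also have "\<dots> \<le> \<epsilon> * (\<eta> * \<bar>g\<bar> / 2)" unfolding mult.left_commute[of \<kappa>] using \<kappa>B \<epsilon> by (intro mult_left_mono) auto
    finally show ?thesis .
  qed
  have contG: "continuous_on {-\<eta>..\<eta>} (\<lambda>y. g * G (\<epsilon> *\<^sub>R u y))"
  proof -
    have "continuous_on {-\<eta>..\<eta>} (\<lambda>y. G (\<epsilon> * \<sigma>, \<epsilon> * (\<sigma> * k + y)))"
      by (rule continuous_on_compose2[OF cont[of "\<epsilon> * \<sigma>"]])
        (use small(1) in \<open>auto intro!: continuous_intros simp: u_def\<close>)
    then show ?thesis by (auto intro!: continuous_intros simp: u_def)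
  qed
  have gg: "0 < g * g" using nz by (auto simp: g_def zero_less_mult_iff linorder_neq_iff)
  \<comment> \<open>The factor g makes the leading term increasing in y whatever the sign of g. The
    error is at most half its size at the ends, so \<open>g * G\<close> changes sign between
    them.\<close>
  have "g * G (\<epsilon> *\<^sub>R u y) - \<epsilon> * y * (g * g) \<in> {- \<epsilon> * \<eta> * (g * g) / 2 .. \<epsilon> * \<eta> * (g * g) / 2}" if "\<bar>y\<bar> \<le> \<eta>" for y
  proof -
    have "\<bar>g * (G (\<epsilon> *\<^sub>R u y) - \<epsilon> * (y * g))\<bar> \<le> \<bar>g\<bar> * (\<epsilon> * (\<eta> * \<bar>g\<bar> / 2))"
      unfolding abs_mult[of g] using Ge[OF that] by (intro mult_left_mono) auto
    also have "\<dots> = \<epsilon> * \<eta> * (g * g) / 2" 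
      using abs_mult_self_eq[of g] by (simp only: times_divide_eq_right mult.assoc mult.left_commute[of "\<bar>g\<bar>"])
    finally have "\<bar>g * (G (\<epsilon> *\<^sub>R u y) - \<epsilon> * (y * g))\<bar> \<le> \<epsilon> * \<eta> * (g * g) / 2" .
    moreover have "g * (G (\<epsilon> *\<^sub>R u y) - \<epsilon> * (y * g)) = g * G (\<epsilon> *\<^sub>R u y) - \<epsilon> * y * (g * g)"
      by (simp add: algebra_simps)
    ultimately show ?thesis unfolding atLeastAtMost_iff by linarith
  qed
  from this[of "-\<eta>"] this[of \<eta>] \<eta> gg \<epsilon>
  have "g * G (\<epsilon> *\<^sub>R u (-\<eta>)) \<le> 0" "0 \<le> g * G (\<epsilon> *\<^sub>R u \<eta>)"
    using mult_pos_pos[OF mult_pos_pos[OF \<epsilon> \<eta>] gg] by auto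
  then obtain y where y: "-\<eta> \<le> y" "y \<le> \<eta>" "g * G (\<epsilon> *\<^sub>R u y) = 0"
    using IVT'[of "\<lambda>y. g * G (\<epsilon> *\<^sub>R u y)" "-\<eta>" 0 \<eta>] contG \<eta> by auto
  then have "G (\<epsilon> *\<^sub>R u y) = 0" using nz by (simp add: g_def)
  moreover have ya: "\<bar>y\<bar> \<le> \<eta>" using y by auto
  ultimately have "J 0 \<le> J (\<epsilon> *\<^sub>R u y)" using min small(1) by blast
  moreover have "J (\<epsilon> *\<^sub>R u y) - J 0 \<le> \<epsilon> * J' (u y) + \<kappa> * norm (\<epsilon> *\<^sub>R u y)"
    using s1(2)[OF small(2)[OF ya]] by (simp add: J.scaleR abs_le_iff)
  moreover have "\<kappa> * norm (\<epsilon> *\<^sub>R u y) \<le> \<epsilon> * (\<bar>A\<bar> / 4)"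
  proof -
    have "\<kappa> * norm (\<epsilon> *\<^sub>R u y) \<le> \<kappa> * (\<epsilon> * B)" using nu[OF ya] \<kappa> by (intro mult_left_mono) auto
    also have "\<dots> \<le> \<epsilon> * (\<bar>A\<bar> / 4)" unfolding mult.left_commute[of \<kappa>] using \<kappa>B \<epsilon> by (intro mult_left_mono) auto
    finally show ?thesis .
  qed
  moreover have "\<epsilon> * J' (u y) \<le> \<epsilon> * (- \<bar>A\<bar> / 2)"
    unfolding u_def using Jv[OF ya] \<epsilon> by (intro mult_left_mono) auto
  \<comment> \<open>The increment of \<open>J\<close> is at most \<epsilon> |A| (-1/2 + 1/4) < 0,
    against minimality.\<close>
  moreover have "0 < \<epsilon> * \<bar>A\<bar>" using \<epsilon> A by simp
  ultimately show False by simp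
qed

subsection \<open>Differentiability of the functionals\<close>

lemma D_on_eq:
  assumes "a < b" "t \<in> {a..b}" "(y has_real_derivative d) (at t within {a..b})"
  shows "D_on a b y t = d"
  unfolding D_on_def
  using vector_derivative_within_closed_interval[OF assms(1,2)] assms(3)
  by (simp add: has_real_derivative_iff_has_vector_derivative)

lemma C1_on_interval:
  fixes y :: "real \<Rightarrow> real"
  assumes ab: "a < b" and y: "C1_on {a..b} y"
  shows "\<And>t. t \<in> {a..b} \<Longrightarrow> (y has_real_derivative D_on a b y t) (at t within {a..b})"
    and "continuous_on {a..b} (D_on a b y)"
proof -
  obtain f' :: "real \<Rightarrow> real \<Rightarrow>\<^sub>L real" where
    f': "\<And>t. t \<in> {a..b} \<Longrightarrow> (y has_derivative blinfun_apply (f' t)) (at t within {a..b})"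
      "continuous_on {a..b} f'"
    using y unfolding C1_on_def by blast
  have d: "(y has_real_derivative blinfun_apply (f' t) 1) (at t within {a..b})" if "t \<in> {a..b}" for t
  proof -
    have "blinfun_apply (f' t) = (*) (blinfun_apply (f' t) 1)"
    proof
      fix r
      show "blinfun_apply (f' t) r = blinfun_apply (f' t) 1 * r"
        using blinfun.scaleR_right[of "f' t" r 1] by simp
    qed
    then show ?thesis using f'(1)[OF that] unfolding has_field_derivative_def by simp
  qed
  then have e: "D_on a b y t = blinfun_apply (f' t) 1" if "t \<in> {a..b}" for t
    using D_on_eq[OF ab that] that by blast
  show "(y has_real_derivative D_on a b y t) (at t within {a..b})" if "t \<in> {a..b}" for t
    using d e that by simp
  have "continuous_on {a..b} (\<lambda>t. blinfun_apply (f' t) 1)"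
    by (intro continuous_intros f')
  then show "continuous_on {a..b} (D_on a b y)"
    by (rule continuous_on_eq) (simp add: e)
qed

lemma C1_on_intervalI:
  fixes y :: "real \<Rightarrow> real"
  assumes "\<And>t. t \<in> {a..b} \<Longrightarrow> (y has_real_derivative e t) (at t within {a..b})"
    and "continuous_on {a..b} e"
  shows "C1_on {a..b} y"
  unfolding C1_on_def
proof (intro exI conjI ballI)
  show "(y has_derivative blinfun_apply (blinfun_scaleR_left (e t))) (at t within {a..b})"
    if "t \<in> {a..b}" for t
    using assms(1)[OF that] unfolding has_field_derivative_def
    by (rule has_derivative_eq_rhs) (auto simp: fun_eq_iff)
  show "continuous_on {a..b} (\<lambda>t. blinfun_scaleR_left (e t))"
    by (intro bounded_linear.continuous_on[OF bounded_linear_blinfun_scaleR_left] assms)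
qed

text \<open>Fixing t restricts the derivative to the slice {t} x R^2, which lies in
  \<open>S \<times> UNIV\<close> and is parametrised by the full plane. So the partial derivatives
  in u and v are two-sided even when t is a boundary point of S.\<close>

lemma has_derivative_partials:
  fixes F :: "real \<Rightarrow> real \<Rightarrow> real \<Rightarrow> real"
  assumes D: "((\<lambda>(t, u, v). F t u v) has_derivative D) (at (t, u, v) within S \<times> UNIV)" and t: "t \<in> S"
  shows "((\<lambda>p. F t (fst p) (snd p)) has_derivative
      (\<lambda>p. pd2 F t u v * fst p + pd3 F t u v * snd p)) (at (u, v))"
    and "pd2 F t u v = D (0, 1, 0)" "pd3 F t u v = D (0, 0, 1)"
    and "((\<lambda>u. F t u v) has_real_derivative pd2 F t u v) (at u)"
    and "((\<lambda>v. F t u v) has_real_derivative pd3 F t u v) (at v)"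
proof -
  interpret D: bounded_linear D using D by (rule has_derivative_bounded_linear)
  have 1: "((\<lambda>p. (t, p)) has_derivative (\<lambda>p. (0, p))) (at (u, v))"
    by (auto intro!: derivative_eq_intros)
  have "((\<lambda>(t, u, v). F t u v) has_derivative D) (at (t, u, v) within (Pair t ` UNIV))"
    by (rule has_derivative_subset[OF D]) (use t in auto)
  from has_derivative_in_compose[OF 1 this]
  have 2: "((\<lambda>p. F t (fst p) (snd p)) has_derivative (\<lambda>p. D (0, p))) (at (u, v))"
    by (simp add: case_prod_beta)
  have lin: "D (0, p, q) = D (0, 1, 0) * p + D (0, 0, 1) * q" for p q
  proof -
    have "(0, p, q) = p *\<^sub>R (0, 1, 0) + q *\<^sub>R (0 :: real, 0, 1)" by simp
    then have "D (0, p, q) = D (p *\<^sub>R (0, 1, 0)) + D (q *\<^sub>R (0, 0, 1))" by (simp only: D.add)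
    then show ?thesis by (simp only: D.scaleR) simp
  qed
  have u: "((\<lambda>u. (u, v)) has_derivative (\<lambda>h. (h, 0))) (at u)"
    and v: "((\<lambda>v. (u, v)) has_derivative (\<lambda>h. (0, h))) (at v)"
    by (auto intro!: derivative_eq_intros)
  have lu: "(\<lambda>h. D (0, h, 0)) = (*) (D (0, 1, 0))" and lv: "(\<lambda>h. D (0, 0, h)) = (*) (D (0, 0, 1))"
  proof -
    show "(\<lambda>h. D (0, h, 0)) = (*) (D (0, 1, 0))"
    proof
      fix h show "D (0, h, 0) = D (0, 1, 0) * h" using lin[of h 0] by simp
    qed
    show "(\<lambda>h. D (0, 0, h)) = (*) (D (0, 0, 1))"
    proof
      fix h show "D (0, 0, h) = D (0, 0, 1) * h" using lin[of 0 h] by simp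
    qed
  qed
  have du: "((\<lambda>u. F t u v) has_real_derivative D (0, 1, 0)) (at u)"
    using has_derivative_compose[OF u 2]
    by (simp add: has_field_derivative_def lu)
  have dv: "((\<lambda>v. F t u v) has_real_derivative D (0, 0, 1)) (at v)"
    using has_derivative_compose[OF v 2]
    by (simp add: has_field_derivative_def lv)
  show p2: "pd2 F t u v = D (0, 1, 0)" and p3: "pd3 F t u v = D (0, 0, 1)"
    unfolding pd2_def pd3_def using du dv by (auto intro: DERIV_imp_deriv)
  show "((\<lambda>u. F t u v) has_real_derivative pd2 F t u v) (at u)"
    "((\<lambda>v. F t u v) has_real_derivative pd3 F t u v) (at v)"
    using du dv p2 p3 by auto
  show "((\<lambda>p. F t (fst p) (snd p)) has_derivative
      (\<lambda>p. pd2 F t u v * fst p + pd3 F t u v * snd p)) (at (u, v))"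
    using 2
  proof (rule has_derivative_eq_rhs)
    show "(\<lambda>p. D (0, p)) = (\<lambda>p. pd2 F t u v * fst p + pd3 F t u v * snd p)"
    proof
      fix p show "D (0, p) = pd2 F t u v * fst p + pd3 F t u v * snd p"
        using lin[of "fst p" "snd p"] by (simp add: p2 p3)
    qed
  qed
qed

text \<open>Brings \<open>g\<close> into the form in which \<open>L\<close> is given, so that one
  differentiation lemma covers the functional and the constraint.\<close>

lemma C1_on_partials:
  fixes g :: "real \<Rightarrow> real \<Rightarrow> real \<Rightarrow> real"
  assumes "C1_on (S \<times> UNIV) (\<lambda>(t, u, v). g t u v)"
  shows "(\<lambda>(t, u, v). g t u v) differentiable_on (S \<times> UNIV)"
    and "continuous_on (S \<times> UNIV) (\<lambda>(t, u, v). pd2 g t u v)"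
    and "continuous_on (S \<times> UNIV) (\<lambda>(t, u, v). pd3 g t u v)"
proof -
  obtain f' where f': "\<And>p. p \<in> S \<times> UNIV \<Longrightarrow>
      ((\<lambda>(t, u, v). g t u v) has_derivative blinfun_apply (f' p)) (at p within S \<times> UNIV)"
      "continuous_on (S \<times> UNIV) f'"
    using assms unfolding C1_on_def by blast
  show "(\<lambda>(t, u, v). g t u v) differentiable_on (S \<times> UNIV)"
    using f'(1) unfolding differentiable_on_def differentiable_def by blast
  have "continuous_on (S \<times> UNIV) (\<lambda>p. blinfun_apply (f' p) d)" for d
    by (intro continuous_intros f')
  note c = this
  show "continuous_on (S \<times> UNIV) (\<lambda>(t, u, v). pd2 g t u v)"
    by (rule continuous_on_eq[OF c[of "(0, 1, 0)"]])
      (use has_derivative_partials(2)[OF f'(1)] in auto)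
  show "continuous_on (S \<times> UNIV) (\<lambda>(t, u, v). pd3 g t u v)"
    by (rule continuous_on_eq[OF c[of "(0, 0, 1)"]])
      (use has_derivative_partials(3)[OF f'(1)] in auto)
qed

text \<open>Moving the terminal time also moves the arguments of \<open>h\<close> and
  \<open>h0\<close>, but these carry a factor that vanishes at 0. Their slopes \<open>h1\<close> and
  \<open>h2\<close> thus contribute at second order only and are absent from the derivative.\<close>

lemma has_derivative_terminal:
  fixes \<phi> :: "real \<Rightarrow> real \<Rightarrow> real"
  assumes \<phi>: "((\<lambda>(t, u). \<phi> t u) has_derivative (\<lambda>(p, q). \<phi>1 * p + \<phi>2 * q)) (at (T, x T))"
    and x: "(x has_real_derivative xd) (at T)" and h: "(h has_real_derivative h1) (at T)"
    and h0: "(h0 has_real_derivative h2) (at T)"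
  shows "((\<lambda>w. \<phi> (T + fst w * \<tau>) (x (T + fst w * \<tau>) + fst w * h (T + fst w * \<tau>) + snd w * h0 (T + fst w * \<tau>)))
     has_derivative (\<lambda>w. fst w * (\<tau> * (\<phi>1 + \<phi>2 * xd) + \<phi>2 * h T) + snd w * (\<phi>2 * h0 T))) (at 0)"
proof -
  have s: "((\<lambda>w. T + fst w * \<tau>) has_derivative (\<lambda>w. fst w * \<tau>)) (at (0 :: real \<times> real))"
    by (auto intro!: derivative_eq_intros)
  have c: "((\<lambda>w. f (T + fst w * \<tau>)) has_derivative (\<lambda>w. fst w * \<tau> * d)) (at (0 :: real \<times> real))"
    if "(f has_real_derivative d) (at T)" for f d
    using has_derivative_compose[OF s, of f "(*) d"] that
    by (simp add: has_field_derivative_def mult_ac)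
  have "((\<lambda>w. (T + fst w * \<tau>, x (T + fst w * \<tau>) + fst w * h (T + fst w * \<tau>) + snd w * h0 (T + fst w * \<tau>)))
    has_derivative (\<lambda>w. (fst w * \<tau>, fst w * \<tau> * xd + fst w * h T + snd w * h0 T))) (at 0)"
    by (rule derivative_eq_intros refl s c[OF x] c[OF h] c[OF h0])+ (auto simp: fun_eq_iff)
  moreover have "((\<lambda>(t, u). \<phi> t u) has_derivative (\<lambda>(p, q). \<phi>1 * p + \<phi>2 * q))
      (at (T + fst (0 :: real \<times> real) * \<tau>, x (T + fst (0 :: real \<times> real) * \<tau>) + fst (0 :: real \<times> real) * h (T + fst (0 :: real \<times> real) * \<tau>)
        + snd (0 :: real \<times> real) * h0 (T + fst (0 :: real \<times> real) * \<tau>)))"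
    using \<phi> by simp
  ultimately
  have "((\<lambda>w. \<phi> (T + fst w * \<tau>) (x (T + fst w * \<tau>) + fst w * h (T + fst w * \<tau>) + snd w * h0 (T + fst w * \<tau>)))
     has_derivative (\<lambda>w. \<phi>1 * (fst w * \<tau>) + \<phi>2 * (fst w * \<tau> * xd + fst w * h T + snd w * h0 T))) (at 0)"
    using has_derivative_compose by fastforce
  then show ?thesis by (rule has_derivative_eq_rhs) (auto simp: fun_eq_iff algebra_simps)
qed

text \<open>The parameter enters through the integrand and through the upper limit. The two are
  decoupled as a function of (w, r), differentiated in w by the Leibniz rule and in r by the
  fundamental theorem; the chain rule then inserts the moving limit for r. The pairs (h, k) and (h0,
  k0) stand for variations with their combined Caputo derivatives.\<close>

lemma has_derivative_functional:
  fixes Fn P2 P3 :: "real \<Rightarrow> real \<Rightarrow> real \<Rightarrow> real"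
  assumes T: "a < T" "T < b"
    and F: "continuous_on ({a..b} \<times> UNIV) (\<lambda>(t, u, v). Fn t u v)"
    and D: "\<forall>t\<in>{a..b}. \<forall>u v. ((\<lambda>p. Fn t (fst p) (snd p)) has_derivative
        (\<lambda>p. P2 t u v * fst p + P3 t u v * snd p)) (at (u, v))"
    and P2: "continuous_on ({a..b} \<times> UNIV) (\<lambda>(t, u, v). P2 t u v)"
    and P3: "continuous_on ({a..b} \<times> UNIV) (\<lambda>(t, u, v). P3 t u v)"
    and c: "continuous_on {a..b} x" "continuous_on {a..b} z" "continuous_on {a..b} h"
      "continuous_on {a..b} k" "continuous_on {a..b} h0" "continuous_on {a..b} k0"
  shows "((\<lambda>w. integral {a..T + fst w * \<tau>}
             (\<lambda>t. Fn t (x t + fst w * h t + snd w * h0 t) (z t + fst w * k t + snd w * k0 t)))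
          has_derivative
          (\<lambda>w. fst w * (\<tau> * Fn T (x T) (z T) + integral {a..T} (\<lambda>t. P2 t (x t) (z t) * h t + P3 t (x t) (z t) * k t))
             + snd w * integral {a..T} (\<lambda>t. P2 t (x t) (z t) * h0 t + P3 t (x t) (z t) * k0 t))) (at 0)"
    and "\<And>w. T + fst w * \<tau> \<le> b \<Longrightarrow>
      continuous_on {a..T + fst w * \<tau>} (\<lambda>t. Fn t (x t + fst w * h t + snd w * h0 t) (z t + fst w * k t + snd w * k0 t))"
    and "\<And>p. T + p * \<tau> \<le> b \<Longrightarrow>
      continuous_on UNIV (\<lambda>q. integral {a..T + p * \<tau>} (\<lambda>t. Fn t (x t + p * h t + q * h0 t) (z t + p * k t + q * k0 t)))"
proof -
  define X where "X w t = x t + fst w * h t + snd w * h0 t" for w :: "real \<times> real" and t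
  define Z where "Z w t = z t + fst w * k t + snd w * k0 t" for w :: "real \<times> real" and t
  have comp: "continuous_on (S \<times> {a..b}) (\<lambda>(w, t). H t (X w t) (Z w t))"
    if "continuous_on ({a..b} \<times> UNIV) (\<lambda>(t, u, v). H t u v)" for H :: "real \<Rightarrow> real \<Rightarrow> real \<Rightarrow> real" and S
  proof -
    have s: "continuous_on (S \<times> {a..b}) (\<lambda>p. f (snd p))" if "continuous_on {a..b} f" for f :: "real \<Rightarrow> real"
      by (rule continuous_on_compose2[OF that]) (auto intro!: continuous_intros)
    have 1: "continuous_on (S \<times> {a..b}) (\<lambda>p. (snd p, X (fst p) (snd p), Z (fst p) (snd p)))"
      unfolding X_def Z_def by (intro continuous_intros s c)
    have 2: "(\<lambda>p. (snd p, X (fst p) (snd p), Z (fst p) (snd p))) ` (S \<times> {a..b}) \<subseteq> {a..b} \<times> UNIV"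
      by auto
    show ?thesis using continuous_on_compose2[OF that 1 2] by (simp add: case_prod_beta)
  qed
  define G where "G w t = Fn t (X w t) (Z w t)" for w t
  have Gc: "continuous_on (S \<times> {a..b}) (\<lambda>(w, t). G w t)" for S
    unfolding G_def by (rule comp[OF F])
  have Gt: "continuous_on {a..b} (G w)" for w
  proof -
    have "continuous_on {a..b} (\<lambda>t. (\<lambda>(w, t). G w t) (w, t))"
      by (rule continuous_on_compose2[OF Gc[of UNIV]]) (auto intro!: continuous_intros)
    then show ?thesis by simp
  qed
  define Y where "Y = {a<..<b}"
  define fx where "fx w t = (P2 t (X w t) (Z w t) * h t + P3 t (X w t) (Z w t) * k t) *\<^sub>R fst_blinfun
      + (P2 t (X w t) (Z w t) * h0 t + P3 t (X w t) (Z w t) * k0 t) *\<^sub>R (snd_blinfun :: (real \<times> real) \<Rightarrow>\<^sub>L real)" for w t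
  have fxc: "continuous_on (UNIV \<times> {a..T}) (\<lambda>(w, t). fx w t)"
  proof -
    have s: "continuous_on (UNIV \<times> {a..b}) (\<lambda>p :: (real \<times> real) \<times> real. f (snd p))"
      if "continuous_on {a..b} f" for f :: "real \<Rightarrow> real"
      by (rule continuous_on_compose2[OF that]) (auto intro!: continuous_intros)
    have "continuous_on (UNIV \<times> {a..b}) (\<lambda>(w, t). fx w t)"
      unfolding fx_def case_prod_beta
      by (intro continuous_intros s c comp[OF P2, unfolded case_prod_beta] comp[OF P3, unfolded case_prod_beta])
    then show ?thesis by (rule continuous_on_subset) (use T in auto)
  qed
  have fxt: "continuous_on {a..T} (fx w)" for w
  proof -
    have "continuous_on {a..T} (\<lambda>t. (\<lambda>(w, t). fx w t) (w, t))"
      by (rule continuous_on_compose2[OF fxc]) (auto intro!: continuous_intros)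
    then show ?thesis by simp
  qed
  have d1: "((\<lambda>w. G w t) has_derivative blinfun_apply (fx w t)) (at w)" if t: "t \<in> {a..b}" for w t
  proof -
    have "((\<lambda>w. (X w t, Z w t)) has_derivative
        (\<lambda>w. (fst w * h t + snd w * h0 t, fst w * k t + snd w * k0 t))) (at w)"
      unfolding X_def Z_def by (auto intro!: derivative_eq_intros)
    from has_derivative_compose[OF this D[rule_format, OF t, of "X w t" "Z w t"]]
    moreover have "blinfun_apply (fx w t) = (\<lambda>v. P2 t (X w t) (Z w t) * (fst v * h t + snd v * h0 t)
        + P3 t (X w t) (Z w t) * (fst v * k t + snd v * k0 t))"
      by (auto simp: fun_eq_iff fx_def blinfun.add_left blinfun.scaleR_left algebra_simps)
    ultimately show ?thesis by (simp add: G_def)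
  qed
  have "((\<lambda>w. integral (cbox a T) (G w)) has_derivative blinfun_apply (integral (cbox a T) (fx 0))) (at 0 within UNIV)"
  proof (rule leibniz_rule)
    show "((\<lambda>w. G w t) has_derivative blinfun_apply (fx w t)) (at w within UNIV)" if "t \<in> cbox a T" for w t
      using d1[of t w] that T by auto
    show "G w integrable_on cbox a T" for w
      using continuous_on_subset[OF Gt[of w], of "{a..T}"] T by (auto intro!: integrable_continuous_real)
    show "continuous_on (UNIV \<times> cbox a T) (\<lambda>(w, t). fx w t)" using fxc by simp
  qed auto
  then have D1: "((\<lambda>w. integral {a..T} (G w)) has_derivative blinfun_apply (integral {a..T} (fx 0))) (at 0 within UNIV)"
    by simp
  \<comment> \<open>The criterion for joint differentiability takes the derivative in w at r = T
    only, but the one in r for all r in a convex set \<open>Y\<close>, continuous at (0, T). As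
    \<open>Y\<close> is open, the restriction to it disappears afterwards.\<close>
  have D2: "((\<lambda>r. integral {a..r} (G w)) has_derivative blinfun_apply (blinfun_scaleR_left (G w r))) (at r within Y)"
    if "r \<in> Y" for w r
  proof -
    have "((\<lambda>r. integral {a..r} (G w)) has_real_derivative G w r) (at r within {a..b})"
      by (rule integral_has_real_derivative[OF Gt]) (use that in \<open>auto simp: Y_def\<close>)
    then have "((\<lambda>r. integral {a..r} (G w)) has_real_derivative G w r) (at r within Y)"
      by (rule has_field_derivative_subset) (auto simp: Y_def)
    then show ?thesis
      unfolding has_field_derivative_def by (rule has_derivative_eq_rhs) (auto simp: fun_eq_iff)
  qed
  have D3: "continuous (at (0, T) within UNIV \<times> Y) (\<lambda>(w, r). blinfun_scaleR_left (G w r))"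
  proof -
    have "continuous_on (UNIV \<times> Y) (\<lambda>p. (\<lambda>(w, t). G w t) p)"
      by (rule continuous_on_subset[OF Gc[of UNIV]]) (auto simp: Y_def)
    then have c: "continuous_on (UNIV \<times> Y) (\<lambda>p. blinfun_scaleR_left ((\<lambda>(w, t). G w t) p))"
      by (intro bounded_linear.continuous_on[OF bounded_linear_blinfun_scaleR_left])
    have "(0, T) \<in> UNIV \<times> Y" using T by (simp add: Y_def)
    from bspec[OF c[unfolded continuous_on_eq_continuous_within] this] show ?thesis
      by (simp add: case_prod_unfold)
  qed
  have "((\<lambda>(w, r). integral {a..r} (G w)) has_derivative
      (\<lambda>(tw, tr). blinfun_apply (integral {a..T} (fx 0)) tw + blinfun_apply (blinfun_scaleR_left (G 0 T)) tr))
      (at (0, T) within UNIV \<times> Y)"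
    by (rule has_derivative_partialsI[OF D1 D2 D3]) (use T in \<open>auto simp: Y_def\<close>)
  then have D4: "((\<lambda>(w, r). integral {a..r} (G w)) has_derivative
      (\<lambda>(tw, tr). blinfun_apply (integral {a..T} (fx 0)) tw + tr * G 0 T)) (at (0, T))"
    by (subst (asm) at_within_open) (use T in \<open>auto simp: Y_def open_Times\<close>)
  have D5: "((\<lambda>w. (w, T + fst w * \<tau>)) has_derivative (\<lambda>w. (w, fst w * \<tau>))) (at (0 :: real \<times> real))"
    by (auto intro!: derivative_eq_intros)
  have D4': "((\<lambda>p. integral {a..snd p} (G (fst p))) has_derivative
      (\<lambda>p. blinfun_apply (integral {a..T} (fx 0)) (fst p) + snd p * G 0 T)) (at (0, T + fst (0 :: real \<times> real) * \<tau>))"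
    using D4 by (simp add: case_prod_unfold)
  have "((\<lambda>w. integral {a..T + fst w * \<tau>} (G w)) has_derivative
      (\<lambda>w. blinfun_apply (integral {a..T} (fx 0)) w + fst w * \<tau> * G 0 T)) (at 0)"
    using has_derivative_compose[OF D5 D4'] by simp
  moreover have "blinfun_apply (integral {a..T} (fx 0)) w =
      fst w * integral {a..T} (\<lambda>t. P2 t (x t) (z t) * h t + P3 t (x t) (z t) * k t)
      + snd w * integral {a..T} (\<lambda>t. P2 t (x t) (z t) * h0 t + P3 t (x t) (z t) * k0 t)" for w
  proof -
    have s: "continuous_on {a..T} (\<lambda>t. P t (x t) (z t) * f t)"
      if "continuous_on ({a..b} \<times> UNIV) (\<lambda>(t, u, v). P t u v)" "continuous_on {a..b} f" for P and f :: "real \<Rightarrow> real"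
    proof -
      have "continuous_on {a..b} (\<lambda>t. (t, x t, z t))" by (intro continuous_intros c)
      from continuous_on_compose2[OF that(1) this] that(2)
      have "continuous_on {a..b} (\<lambda>t. P t (x t) (z t) * f t)" by (auto intro!: continuous_intros)
      then show ?thesis by (rule continuous_on_subset) (use T in auto)
    qed
    have "blinfun_apply (integral {a..T} (fx 0)) w = integral {a..T} (\<lambda>t. blinfun_apply (fx 0 t) w)"
      by (rule blinfun_apply_integral) (intro integrable_continuous_real fxt)
    also have "\<dots> = integral {a..T} (\<lambda>t. fst w * (P2 t (x t) (z t) * h t + P3 t (x t) (z t) * k t)
        + snd w * (P2 t (x t) (z t) * h0 t + P3 t (x t) (z t) * k0 t))"
      by (simp add: fx_def X_def Z_def blinfun.add_left blinfun.scaleR_left mult.commute)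
    also have "\<dots> = integral {a..T} (\<lambda>t. fst w * (P2 t (x t) (z t) * h t + P3 t (x t) (z t) * k t))
        + integral {a..T} (\<lambda>t. snd w * (P2 t (x t) (z t) * h0 t + P3 t (x t) (z t) * k0 t))"
      by (intro Henstock_Kurzweil_Integration.integral_add integrable_continuous_real continuous_intros s P2 P3 c)
    finally show ?thesis by simp
  qed
  moreover have "G w = (\<lambda>t. Fn t (x t + fst w * h t + snd w * h0 t) (z t + fst w * k t + snd w * k0 t))" for w
    by (simp add: G_def X_def Z_def fun_eq_iff)
  ultimately show "((\<lambda>w. integral {a..T + fst w * \<tau>}
             (\<lambda>t. Fn t (x t + fst w * h t + snd w * h0 t) (z t + fst w * k t + snd w * k0 t)))
          has_derivative
          (\<lambda>w. fst w * (\<tau> * Fn T (x T) (z T) + integral {a..T} (\<lambda>t. P2 t (x t) (z t) * h t + P3 t (x t) (z t) * k t))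
             + snd w * integral {a..T} (\<lambda>t. P2 t (x t) (z t) * h0 t + P3 t (x t) (z t) * k0 t))) (at 0)"
    by (simp add: algebra_simps)
  show "continuous_on {a..T + fst w * \<tau>} (\<lambda>t. Fn t (x t + fst w * h t + snd w * h0 t) (z t + fst w * k t + snd w * k0 t))"
    if "T + fst w * \<tau> \<le> b" for w
    using continuous_on_subset[OF Gt[of w], of "{a..T + fst w * \<tau>}"] that by (auto simp: G_def X_def Z_def)
  show "continuous_on UNIV (\<lambda>q. integral {a..T + p * \<tau>} (\<lambda>t. Fn t (x t + p * h t + q * h0 t) (z t + p * k t + q * k0 t)))"
    if "T + p * \<tau> \<le> b" for p
  proof -
    have "continuous_on (UNIV \<times> cbox a (T + p * \<tau>)) (\<lambda>(q, t). G (p, q) t)"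
    proof -
      have "continuous_on (UNIV \<times> cbox a (T + p * \<tau>)) (\<lambda>r. (\<lambda>(w, t). G w t) ((p, fst r), snd r))"
        by (rule continuous_on_compose2[OF Gc[of UNIV]]) (use that in \<open>auto intro!: continuous_intros\<close>)
      then show ?thesis by (simp add: case_prod_beta)
    qed
    from integral_continuous_on_param[OF this] show ?thesis by (simp add: G_def X_def Z_def)
  qed
qed

subsection \<open>Variations of the combined Caputo derivative\<close>

locale combined_orders = A: variable_order a b \<alpha> + B: variable_order a b \<beta> for a b \<alpha> \<beta> +
  fixes \<gamma>1 \<gamma>2 T :: real
  assumes T: "a < T" "T < b"
begin

abbreviation "cc \<equiv> combined_caputo a b \<alpha> \<beta> \<gamma>1 \<gamma>2"

text \<open>The argument is the derivative e = x', not x. The operator is linear on continuous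
  functions, so the combined Caputo derivative of a varied function follows by addition once the
  ordinary derivatives are known.\<close>

definition caputo_op :: "(real \<Rightarrow> real) \<Rightarrow> real \<Rightarrow> real" where
  "caputo_op e t = \<gamma>1 * left_op a b \<alpha> (cutoff a b e) t - \<gamma>2 * right_op a b \<beta> (cutoff a b e) t"

text \<open>The first variation of \<open>\<integral>\<^sub>a\<^sup>T F[x]\<close> in the direction \<open>h = \<integral>\<^sub>a e\<close> is the integral of \<open>e\<close>
  against this function, where \<open>q = \<partial>\<^sub>2F[x]\<close> and \<open>p = \<partial>\<^sub>3F[x]\<close>.\<close>

definition variation_kernel :: "(real \<Rightarrow> real) \<Rightarrow> (real \<Rightarrow> real) \<Rightarrow> real \<Rightarrow> real" where
  "variation_kernel q p s = right_op a b (\<lambda>_ _. 0) (cutoff a T q) s + \<gamma>1 * right_op a b \<alpha> (cutoff a T p) s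
     - \<gamma>2 * left_op a b \<beta> (cutoff a T p) s"

sublocale Z: variable_order a b "\<lambda>_ _. 0"
  by (rule variable_order_zero[OF A.ab])

lemma combined_caputo_eq_caputo_op:
  assumes "t \<in> {a..b}" and "\<And>s. s \<in> {a..b} \<Longrightarrow> D_on a b y s = e s"
  shows "cc y t = caputo_op e t"
proof -
  have "cutoff a b (D_on a b y) = cutoff a b e" by (rule cutoff_cong) (rule assms)
  then show ?thesis
    using assms(1) unfolding combined_caputo_def caputo_left_def caputo_right_def caputo_op_def
    by (simp add: A.RL_left_eq_left_op[of a t b] B.RL_right_eq_right_op[of t a b])
qed

lemma caputo_op_add:
  assumes "continuous_on {a..b} f" "continuous_on {a..b} g"
  shows "caputo_op (\<lambda>s. f s + k * g s) t = caputo_op f t + k * caputo_op g t"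
  unfolding caputo_op_def A.left_op_linear[OF assms] B.right_op_linear[OF assms] by (simp add: algebra_simps)

lemma caputo_op_zero: "caputo_op (\<lambda>_. 0) t = 0"
  by (simp add: caputo_op_def left_op_def right_op_def cutoff_def)

lemma continuous_on_caputo_op: "continuous_on {a..b} e \<Longrightarrow> continuous_on {a..b} (caputo_op e)"
  unfolding caputo_op_def by (intro continuous_intros A.continuous_on_left_op_cutoff B.continuous_on_right_op_cutoff)

lemma continuous_on_variation_kernel:
  assumes "continuous_on {a..T} q" "continuous_on {a..T} p"
  shows "continuous_on {a..b} (variation_kernel q p)"
  unfolding variation_kernel_def
  by (intro continuous_intros Z.continuous_on_right_op_cutoff A.continuous_on_right_op_cutoff
      B.continuous_on_left_op_cutoff assms)

lemma variation_kernel_add: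
  assumes "continuous_on {a..T} q" "continuous_on {a..T} p" "continuous_on {a..T} q'" "continuous_on {a..T} p'"
  shows "variation_kernel (\<lambda>s. q s + k * q' s) (\<lambda>s. p s + k * p' s) t = variation_kernel q p t + k * variation_kernel q' p' t"
  unfolding variation_kernel_def Z.right_op_linear[OF assms(1,3)] A.right_op_linear[OF assms(2,4)] B.left_op_linear[OF assms(2,4)]
  by (simp add: algebra_simps)

text \<open>Three transpositions, in which left and right operators exchange their roles. Writing
  the primitive of \<open>e\<close> as the left operator of order 0 puts the term with
  \<open>q\<close> on the same footing as the fractional ones.\<close>

lemma first_variation:
  assumes e: "continuous_on {a..b} e" and q: "continuous_on {a..T} q" and p: "continuous_on {a..T} p"
  shows "integral {a..T} (\<lambda>t. q t * integral {a..t} e + p t * caputo_op e t) = integral {a..b} (\<lambda>s. e s * variation_kernel q p s)"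
proof -
  have sub: "{a..T} \<subseteq> {a..b}" using T by auto
  note c = continuous_on_subset[OF Z.continuous_on_left_op_cutoff[OF e] sub]
    continuous_on_subset[OF A.continuous_on_left_op_cutoff[OF e] sub]
    continuous_on_subset[OF B.continuous_on_right_op_cutoff[OF e] sub]
  note c' = Z.continuous_on_right_op_cutoff[OF q] A.continuous_on_right_op_cutoff[OF p] B.continuous_on_left_op_cutoff[OF p]
  let ?i = "\<lambda>f. integral {a..T} f" and ?j = "\<lambda>f. integral {a..b} f"
  have "?i (\<lambda>t. q t * integral {a..t} e + p t * caputo_op e t) =
      ?i (\<lambda>t. q t * left_op a b (\<lambda>_ _. 0) (cutoff a b e) t + p t * caputo_op e t)"
    by (intro integral_cong) (use T in \<open>simp add: left_op_zero[OF A.ab e]\<close>)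
  also have "\<dots> = ?i (\<lambda>t. q t * left_op a b (\<lambda>_ _. 0) (cutoff a b e) t
      + (\<gamma>1 * (p t * left_op a b \<alpha> (cutoff a b e) t) - \<gamma>2 * (p t * right_op a b \<beta> (cutoff a b e) t)))"
    by (simp add: caputo_op_def algebra_simps)
  also have "\<dots> = ?i (\<lambda>t. q t * left_op a b (\<lambda>_ _. 0) (cutoff a b e) t)
      + (\<gamma>1 * ?i (\<lambda>t. p t * left_op a b \<alpha> (cutoff a b e) t) - \<gamma>2 * ?i (\<lambda>t. p t * right_op a b \<beta> (cutoff a b e) t))"
    by (subst Henstock_Kurzweil_Integration.integral_add Henstock_Kurzweil_Integration.integral_diff,
        (intro integrable_continuous_real continuous_intros c p q)+)+ simp
  also have "\<dots> = ?j (\<lambda>s. e s * right_op a b (\<lambda>_ _. 0) (cutoff a T q) s)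
      + (\<gamma>1 * ?j (\<lambda>s. e s * right_op a b \<alpha> (cutoff a T p) s) - \<gamma>2 * ?j (\<lambda>s. e s * left_op a b \<beta> (cutoff a T p) s))"
    using T by (simp add: Z.integral_mult_left_op[OF e q] A.integral_mult_left_op[OF e p] B.integral_mult_right_op[OF e p])
  also have "\<dots> = ?j (\<lambda>s. e s * right_op a b (\<lambda>_ _. 0) (cutoff a T q) s
      + (\<gamma>1 * (e s * right_op a b \<alpha> (cutoff a T p) s) - \<gamma>2 * (e s * left_op a b \<beta> (cutoff a T p) s)))"
    by (subst Henstock_Kurzweil_Integration.integral_add Henstock_Kurzweil_Integration.integral_diff,
        (intro integrable_continuous_real continuous_intros c' e)+)+ simp
  also have "\<dots> = ?j (\<lambda>s. e s * variation_kernel q p s)"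
    by (simp add: variation_kernel_def algebra_simps)
  finally show ?thesis .
qed

text \<open>Past T the right operators meet only the zero part of the cut-off functions, and what
  survives is the left operator of order \<beta>. At s = b this is the left-hand side of the third
  condition.\<close>

lemma variation_kernel_beyond:
  assumes p: "continuous_on {a..b} p" and s: "s \<in> {T..b}"
  shows "variation_kernel q p s = - \<gamma>2 * (RL_left_int \<beta> a p s - RL_left_int \<beta> T p s)"
  using s T B.RL_left_diff_eq_left_op[OF p, of T s] by (simp add: variation_kernel_def right_op_cutoff_beyond)

text \<open>On [a, T], V = 0 says that \<open>\<gamma>2\<close> times the left integral of
  \<open>p\<close> minus \<open>\<gamma>1\<close> times the right one equals the integral of
  \<open>q\<close> from s to T, whose derivative in s is -q. So the combination is differentiable,
  although its two terms need not be so separately.\<close>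

lemma variation_kernel_eq_zero_imp:
  assumes q: "continuous_on {a..b} q" and p: "continuous_on {a..b} p"
    and V: "\<And>s. s \<in> {a..b} \<Longrightarrow> variation_kernel q p s = 0"
  shows "\<forall>t\<in>{a..T}. \<exists>D. has_dual_deriv a \<alpha> \<beta> \<gamma>1 \<gamma>2 T p D t \<and> q t + D = 0"
    and "\<forall>t\<in>{T..b}. has_left_diff_deriv a b \<beta> \<gamma>2 T p 0 t"
proof -
  have qT: "continuous_on {a..T} q" by (rule continuous_on_subset[OF q]) (use T in auto)
  show "\<forall>t\<in>{a..T}. \<exists>D. has_dual_deriv a \<alpha> \<beta> \<gamma>1 \<gamma>2 T p D t \<and> q t + D = 0"
  proof
    fix t assume t: "t \<in> {a..T}"
    have "((\<lambda>s. \<gamma>2 * RL_left_int \<beta> a p s + \<gamma>1 * - RL_right_int \<alpha> T p s) has_real_derivative - q t) (at t within {a..T})"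
    proof (rule has_field_derivative_transform_within[OF integral_has_real_derivative'[OF qT t] zero_less_one t])
      fix s assume s: "s \<in> {a..T}"
      have "variation_kernel q p s = 0" using V[of s] s T by auto
      then show "integral {s..T} q = \<gamma>2 * RL_left_int \<beta> a p s + \<gamma>1 * - RL_right_int \<alpha> T p s"
        using s T by (simp add: variation_kernel_def right_op_zero[OF A.ab qT s] B.RL_left_eq_left_op[of a s T] A.RL_right_eq_right_op[of s a T])
    qed
    then show "\<exists>D. has_dual_deriv a \<alpha> \<beta> \<gamma>1 \<gamma>2 T p D t \<and> q t + D = 0"
      unfolding has_dual_deriv_def by (intro exI[of _ "- q t"]) auto
  qed
  show "\<forall>t\<in>{T..b}. has_left_diff_deriv a b \<beta> \<gamma>2 T p 0 t"
  proof
    fix t assume t: "t \<in> {T..b}"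
    show "has_left_diff_deriv a b \<beta> \<gamma>2 T p 0 t"
      unfolding has_left_diff_deriv_def
    proof (rule has_field_derivative_transform_within[OF DERIV_const[of 0] zero_less_one t])
      fix s assume s: "s \<in> {T..b}"
      then have "variation_kernel q p s = 0" using V[of s] T by auto
      then show "0 = \<gamma>2 * (RL_left_int \<beta> a p s - RL_left_int \<beta> T p s)"
        unfolding variation_kernel_beyond[OF p s] by simp
    qed
  qed
qed

text \<open>The variation depends linearly on \<open>w\<close>, so its norm is at most a constant
  times the norm of \<open>w\<close>. Only the function space and closeness are settled here; the
  isoperimetric constraint is left to the multiplier rule.\<close>

lemma admissible_variation:
  assumes x: "(x, T) \<in> frac_space a b \<alpha> \<beta> \<gamma>1 \<gamma>2" and e: "continuous_on {a..b} e" "continuous_on {a..b} e0"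
    and \<epsilon>: "\<epsilon> > 0"
  obtains r where "r > 0"
    "\<And>w. norm w < r \<Longrightarrow> \<bar>fst w * \<tau>\<bar> < min (T - a) (b - T) \<and>
      ((\<lambda>t. x t + fst w * integral {a..t} e + snd w * integral {a..t} e0), T + fst w * \<tau>) \<in> frac_space a b \<alpha> \<beta> \<gamma>1 \<gamma>2 \<and>
      (\<forall>t\<in>{a..b}. cc (\<lambda>t. x t + fst w * integral {a..t} e + snd w * integral {a..t} e0) t
          = cc x t + fst w * caputo_op e t + snd w * caputo_op e0 t) \<and>
      frac_norm a b \<alpha> \<beta> \<gamma>1 \<gamma>2 (\<lambda>s. x s - (x s + fst w * integral {a..s} e + snd w * integral {a..s} e0))
         (T - (T + fst w * \<tau>)) < \<epsilon>"
proof -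
  note ab = A.ab
  define h where "h t = integral {a..t} e" for t
  define h0 where "h0 t = integral {a..t} e0" for t
  have hd: "(h has_real_derivative e t) (at t within {a..b})" "(h0 has_real_derivative e0 t) (at t within {a..b})"
    if "t \<in> {a..b}" for t
    unfolding h_def h0_def using e that by (auto intro: integral_has_real_derivative)
  have hc: "continuous_on {a..b} h" "continuous_on {a..b} h0"
    using hd DERIV_continuous_on[of "{a..b}" h e] DERIV_continuous_on[of "{a..b}" h0 e0] by blast+
  have xC: "C1_on {a..b} x" "continuous_on {a..b} (cc x)" using x by (auto simp: frac_space_def)
  note xd = C1_on_interval[OF ab xC(1)]
  have bd: "\<exists>M. \<forall>t\<in>{a..b}. \<bar>f t\<bar> \<le> M" if "continuous_on {a..b} f" for f :: "real \<Rightarrow> real"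
    using compact_imp_bounded[OF compact_continuous_image[OF that]] unfolding bounded_iff by auto
  obtain M1 M2 M3 M4 where M': "\<And>t. t \<in> {a..b} \<Longrightarrow> \<bar>h t\<bar> \<le> M1" "\<And>t. t \<in> {a..b} \<Longrightarrow> \<bar>h0 t\<bar> \<le> M2"
      "\<And>t. t \<in> {a..b} \<Longrightarrow> \<bar>caputo_op e t\<bar> \<le> M3" "\<And>t. t \<in> {a..b} \<Longrightarrow> \<bar>caputo_op e0 t\<bar> \<le> M4"
    using bd[OF hc(1)] bd[OF hc(2)] bd[OF continuous_on_caputo_op[OF e(1)]] bd[OF continuous_on_caputo_op[OF e(2)]] by blast
  define M where "M = max 0 (max (max M1 M2) (max M3 M4))"
  have M: "0 \<le> M" "\<And>t. t \<in> {a..b} \<Longrightarrow> \<bar>h t\<bar> \<le> M" "\<And>t. t \<in> {a..b} \<Longrightarrow> \<bar>h0 t\<bar> \<le> M"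
      "\<And>t. t \<in> {a..b} \<Longrightarrow> \<bar>caputo_op e t\<bar> \<le> M" "\<And>t. t \<in> {a..b} \<Longrightarrow> \<bar>caputo_op e0 t\<bar> \<le> M"
    using M' by (auto simp: M_def le_max_iff_disj)
  \<comment> \<open>Each of the two suprema in the norm costs at most 2M times the norm of
    \<open>w\<close>, and the shift of time costs |\<tau>| times it; the 1 keeps \<open>K\<close>
    positive.\<close>
  define K where "K = 4 * M + \<bar>\<tau>\<bar> + 1"
  have K: "0 < K" using M by (simp add: K_def add_nonneg_pos)
  define r where "r = min \<epsilon> (min (T - a) (b - T)) / K"
  have r: "0 < r" using K \<epsilon> T by (simp add: r_def)
  have rK: "r * K \<le> \<epsilon>" "r * K \<le> min (T - a) (b - T)" using K by (auto simp: r_def)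
  show thesis
  proof (rule that[OF r], unfold h_def[symmetric] h0_def[symmetric], intro conjI ballI)
    fix w :: "real \<times> real" assume w: "norm w < r"
    have wp: "\<bar>fst w\<bar> \<le> norm w" "\<bar>snd w\<bar> \<le> norm w"
      using norm_fst_le[of "fst w" "snd w"] norm_snd_le[of "snd w" "fst w"] by auto
    have wK: "norm w * K < r * K" using w K by simp
    have w\<tau>: "\<bar>fst w * \<tau>\<bar> \<le> norm w * \<bar>\<tau>\<bar>"
      unfolding abs_mult by (intro mult_right_mono wp) auto
    have "norm w * \<bar>\<tau>\<bar> \<le> norm w * K" using M by (intro mult_left_mono) (auto simp: K_def)
    with w\<tau> wK rK show t1: "\<bar>fst w * \<tau>\<bar> < min (T - a) (b - T)" by linarith
    define y where "y t = x t + fst w * h t + snd w * h0 t" for t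
    define d where "d t = (D_on a b x t + fst w * e t) + snd w * e0 t" for t
    have yd: "(y has_real_derivative d t) (at t within {a..b})" if "t \<in> {a..b}" for t
      unfolding y_def d_def using xd(1)[OF that] hd[OF that] by (auto intro!: derivative_eq_intros)
    have dc: "continuous_on {a..b} d" unfolding d_def by (intro continuous_intros xd e)
    have Dy: "D_on a b y t = d t" if "t \<in> {a..b}" for t by (rule D_on_eq[OF ab that yd[OF that]])
    have ccy: "cc y t = cc x t + fst w * caputo_op e t + snd w * caputo_op e0 t"
      if t: "t \<in> {a..b}" for t
    proof -
      have "cc y t = caputo_op d t" by (rule combined_caputo_eq_caputo_op[OF t Dy])
      also have "\<dots> = caputo_op (D_on a b x) t + fst w * caputo_op e t + snd w * caputo_op e0 t"
        unfolding d_def by (subst caputo_op_add, intro continuous_intros xd e, rule e, subst caputo_op_add[OF xd(2) e(1)]) simp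
      also have "caputo_op (D_on a b x) t = cc x t" by (rule combined_caputo_eq_caputo_op[OF t refl, symmetric])
      finally show ?thesis .
    qed
    then show "cc (\<lambda>t. x t + fst w * h t + snd w * h0 t) t = cc x t + fst w * caputo_op e t + snd w * caputo_op e0 t"
      if "t \<in> {a..b}" for t
      using that unfolding y_def by blast
    have "C1_on {a..b} y" by (rule C1_on_intervalI[OF yd dc])
    moreover have "continuous_on {a..b} (cc y)"
      by (rule continuous_on_eq[of _ "\<lambda>t. cc x t + fst w * caputo_op e t + snd w * caputo_op e0 t"])
        (auto intro!: continuous_intros xC continuous_on_caputo_op e simp: ccy)
    ultimately show "((\<lambda>t. x t + fst w * h t + snd w * h0 t), T + fst w * \<tau>) \<in> frac_space a b \<alpha> \<beta> \<gamma>1 \<gamma>2"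
      using t1 unfolding y_def frac_space_def by auto
    define u where "u s = x s - (x s + fst w * h s + snd w * h0 s)" for s
    \<comment> \<open>The leading 0 is the base function to which \<open>caputo_op_add\<close> adds
      the two variations in turn.\<close>
    define ud where "ud s = (0 + (- fst w) * e s) + (- snd w) * e0 s" for s
    have uder: "(u has_real_derivative ud t) (at t within {a..b})" if "t \<in> {a..b}" for t
      unfolding u_def ud_def using hd[OF that] by (auto intro!: derivative_eq_intros)
    have ccu: "cc u t = - (fst w * caputo_op e t + snd w * caputo_op e0 t)" if t: "t \<in> {a..b}" for t
    proof -
      have "cc u t = caputo_op ud t" by (rule combined_caputo_eq_caputo_op[OF t D_on_eq[OF ab _ uder]])
      also have "\<dots> = - (fst w * caputo_op e t + snd w * caputo_op e0 t)"
        unfolding ud_def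
        by (subst caputo_op_add, intro continuous_intros e, rule e, subst caputo_op_add, intro continuous_intros, rule e) (simp add: caputo_op_zero)
      finally show ?thesis .
    qed
    have comb: "\<bar>fst w * p + snd w * q\<bar> \<le> 2 * (norm w * M)" if "\<bar>p\<bar> \<le> M" "\<bar>q\<bar> \<le> M" for p q
    proof -
      have "\<bar>fst w * p\<bar> \<le> norm w * M" "\<bar>snd w * q\<bar> \<le> norm w * M"
        unfolding abs_mult using that wp M by (auto intro!: mult_mono)
      then show ?thesis by linarith
    qed
    have "(SUP s\<in>{a..b}. \<bar>u s\<bar>) \<le> 2 * (norm w * M)"
    proof (rule cSUP_least)
      show "\<bar>u s\<bar> \<le> 2 * (norm w * M)" if "s \<in> {a..b}" for s
        using comb[OF M(2)[OF that] M(3)[OF that]] unfolding u_def by linarith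
    qed (use ab in auto)
    moreover have "(SUP s\<in>{a..b}. \<bar>cc u s\<bar>) \<le> 2 * (norm w * M)"
    proof (rule cSUP_least)
      show "\<bar>cc u s\<bar> \<le> 2 * (norm w * M)" if "s \<in> {a..b}" for s
        using comb[OF M(4)[OF that] M(5)[OF that]] by (simp add: ccu[OF that])
    qed (use ab in auto)
    moreover have "norm w * K = 2 * (norm w * M) + 2 * (norm w * M) + norm w * \<bar>\<tau>\<bar> + norm w"
      by (simp add: K_def algebra_simps)
    ultimately have "frac_norm a b \<alpha> \<beta> \<gamma>1 \<gamma>2 u (T - (T + fst w * \<tau>)) \<le> norm w * K"
      using w\<tau> norm_ge_zero[of w] abs_minus_cancel[of "fst w * \<tau>"]
      unfolding frac_norm_def diff_add_eq_diff_diff_swap diff_self by linarith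
    then show "frac_norm a b \<alpha> \<beta> \<gamma>1 \<gamma>2 (\<lambda>s. x s - (x s + fst w * h s + snd w * h0 s)) (T - (T + fst w * \<tau>)) < \<epsilon>"
      using wK rK unfolding u_def by linarith
  qed
qed

end

subsection \<open>The transversality conditions\<close>

text \<open>T lies strictly inside the interval, so it can be shifted both ways and V can be
  compared on both sides of it. Continuity of \<open>pd2 L\<close> and \<open>pd3 L\<close> permits
  differentiation under the integral. \<open>D_on\<close> stands for derivatives in a variable
  confined to [a, b], \<open>deriv\<close> for the one in the free second variable of
  \<phi>.\<close>

theorem theorem52:
  fixes a b \<gamma>1 \<gamma>2 xa T :: real
    and \<alpha> \<beta> \<phi> :: "real \<Rightarrow> real \<Rightarrow> real"
    and L g :: "real \<Rightarrow> real \<Rightarrow> real \<Rightarrow> real"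
    and \<psi> x :: "real \<Rightarrow> real"
  assumes "a < b"
    and "continuous_on ({a..b} \<times> {a..b}) (\<lambda>(t, s). \<alpha> t s)"
    and "continuous_on ({a..b} \<times> {a..b}) (\<lambda>(t, s). \<beta> t s)"
    and "\<And>t s. t \<in> {a..b} \<Longrightarrow> s \<in> {a..b} \<Longrightarrow> 0 < \<alpha> t s \<and> \<alpha> t s < 1"
    and "\<And>t s. t \<in> {a..b} \<Longrightarrow> s \<in> {a..b} \<Longrightarrow> 0 < \<beta> t s \<and> \<beta> t s < 1"
    and "\<gamma>1 \<in> {0..1}" and "\<gamma>2 \<in> {0..1}" and "\<not> (\<gamma>1 = 0 \<and> \<gamma>2 = 0)"
    and "(\<lambda>(t, u, v). L t u v) differentiable_on ({a..b} \<times> UNIV)"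
    and "continuous_on ({a..b} \<times> UNIV) (\<lambda>(t, u, v). pd2 L t u v)"
    and "continuous_on ({a..b} \<times> UNIV) (\<lambda>(t, u, v). pd3 L t u v)"
    and "C1_on ({a..b} \<times> UNIV) (\<lambda>(t, u). \<phi> t u)"
    and "C1_on ({a..b} \<times> UNIV) (\<lambda>(t, u, v). g t u v)"
    and "\<psi> differentiable_on {a..b}"
    and "a < T" and "T < b"
    and "local_minimizer a b \<alpha> \<beta> \<gamma>1 \<gamma>2 (bolza a b \<alpha> \<beta> \<gamma>1 \<gamma>2 L \<phi>)
           (admissible a b \<alpha> \<beta> \<gamma>1 \<gamma>2 g \<psi> xa) x T"
    and "\<not> (\<forall>t\<in>{a..T}. \<exists>D.
             has_dual_deriv a \<alpha> \<beta> \<gamma>1 \<gamma>2 T (along a b \<alpha> \<beta> \<gamma>1 \<gamma>2 (pd3 g) x) D t \<and>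
             along a b \<alpha> \<beta> \<gamma>1 \<gamma>2 (pd2 g) x t + D = 0)
       \<or> \<not> (\<forall>t\<in>{T..b}.
             has_left_diff_deriv a b \<beta> \<gamma>2 T (along a b \<alpha> \<beta> \<gamma>1 \<gamma>2 (pd3 g) x) 0 t)"
  shows "\<exists>l::real.
     let F = (\<lambda>t u v. L t u v - l * g t u v);
         p = along a b \<alpha> \<beta> \<gamma>1 \<gamma>2 (pd3 F) x
     in along a b \<alpha> \<beta> \<gamma>1 \<gamma>2 F x T + D_on a b (\<lambda>s. \<phi> s (x T)) T + l * D_on a b \<psi> T
          + D_on a b x T * (\<gamma>2 * RL_left_int \<beta> T p T - \<gamma>1 * RL_right_int \<alpha> T p T) = 0 \<and>
        (\<gamma>1 * RL_right_int \<alpha> T p T - \<gamma>2 * RL_left_int \<beta> T p T) + deriv (\<lambda>u. \<phi> T u) (x T) = 0 \<and>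
        \<gamma>2 * (RL_left_int \<beta> T p b - RL_left_int \<beta> a p b) = 0"
proof -
  interpret combined_orders a b \<alpha> \<beta> \<gamma>1 \<gamma>2 T
    by unfold_locales (use assms(1-5) \<open>a < T\<close> \<open>T < b\<close> in \<open>auto intro: less_imp_le\<close>)
  let ?al = "along a b \<alpha> \<beta> \<gamma>1 \<gamma>2"
  obtain \<epsilon> where xadm: "(x, T) \<in> admissible a b \<alpha> \<beta> \<gamma>1 \<gamma>2 g \<psi> xa" and \<epsilon>: "\<epsilon> > 0"
    and min: "\<And>y S. (y, S) \<in> admissible a b \<alpha> \<beta> \<gamma>1 \<gamma>2 g \<psi> xa \<Longrightarrow>
      frac_norm a b \<alpha> \<beta> \<gamma>1 \<gamma>2 (\<lambda>s. x s - y s) (T - S) < \<epsilon> \<Longrightarrow>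
      bolza a b \<alpha> \<beta> \<gamma>1 \<gamma>2 L \<phi> x T \<le> bolza a b \<alpha> \<beta> \<gamma>1 \<gamma>2 L \<phi> y S"
    using assms(17) unfolding local_minimizer_def by blast
  have xF: "(x, T) \<in> frac_space a b \<alpha> \<beta> \<gamma>1 \<gamma>2" and xxa: "x a = xa"
    and xg: "(LBINT t:{a..T}. ?al g x t) = \<psi> T"
    using xadm by (auto simp: admissible_def)
  then have xC: "C1_on {a..b} x" and zc: "continuous_on {a..b} (cc x)" by (auto simp: frac_space_def)
  note xd = C1_on_interval[OF assms(1) xC]
  have xc: "continuous_on {a..b} x" using xd(1) by (rule DERIV_continuous_on)
  have TI: "T \<in> {a..b}" using T by auto
  have atT: "at T within {a..b} = at T" by (rule at_within_Icc_at[OF T])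
  note g1 = C1_on_partials[OF assms(13)]
  have part: "((\<lambda>p. F t (fst p) (snd p)) has_derivative (\<lambda>p. pd2 F t u v * fst p + pd3 F t u v * snd p)) (at (u, v))"
    "((\<lambda>u. F t u v) has_real_derivative pd2 F t u v) (at u)"
    "((\<lambda>v. F t u v) has_real_derivative pd3 F t u v) (at v)"
    if "(\<lambda>(t, u, v). F t u v) differentiable_on ({a..b} \<times> UNIV)" "t \<in> {a..b}" for F t u v
    using that has_derivative_partials[of F _ t u v "{a..b}"]
    unfolding differentiable_on_def differentiable_def by blast+
  note Ld = part[OF assms(9)] and gd = part[OF g1(1)]
  have Ld1: "\<forall>t\<in>{a..b}. \<forall>u v. ((\<lambda>p. L t (fst p) (snd p)) has_derivative
      (\<lambda>p. pd2 L t u v * fst p + pd3 L t u v * snd p)) (at (u, v))"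
    using Ld(1) by blast
  have gd1: "\<forall>t\<in>{a..b}. \<forall>u v. ((\<lambda>p. g t (fst p) (snd p)) has_derivative
      (\<lambda>p. pd2 g t u v * fst p + pd3 g t u v * snd p)) (at (u, v))"
    using gd(1) by blast
  have Lc: "continuous_on ({a..b} \<times> UNIV) (\<lambda>(t, u, v). L t u v)"
    and gc: "continuous_on ({a..b} \<times> UNIV) (\<lambda>(t, u, v). g t u v)"
    by (rule differentiable_imp_continuous_on, rule assms g1)+
  have alc: "continuous_on {a..b} (?al F x)"
    if F: "continuous_on ({a..b} \<times> UNIV) (\<lambda>(t, u, v). F t u v)" for F
  proof -
    have "continuous_on {a..b} (\<lambda>t. (t, x t, cc x t))" by (intro continuous_intros xc zc)
    from continuous_on_compose2[OF F this] show ?thesis by (auto simp: along_def[abs_def])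
  qed
  have sub: "{a..T} \<subseteq> {a..b}" using T by auto
  define Lq where "Lq = ?al (pd2 L) x"
  define Lp where "Lp = ?al (pd3 L) x"
  define gq where "gq = ?al (pd2 g) x"
  define gp where "gp = ?al (pd3 g) x"
  have qpc: "continuous_on {a..b} Lq" "continuous_on {a..b} Lp" "continuous_on {a..b} gq" "continuous_on {a..b} gp"
    unfolding Lq_def Lp_def gq_def gp_def by (intro alc assms g1)+
  note qpT = qpc[THEN continuous_on_subset[OF _ sub]]
  have Vc: "continuous_on {a..b} (variation_kernel Lq Lp)" "continuous_on {a..b} (variation_kernel gq gp)"
    by (intro continuous_on_variation_kernel qpT)+

  obtain D\<phi> where D\<phi>: "((\<lambda>(t, u). \<phi> t u) has_derivative D\<phi>) (at (T, x T) within {a..b} \<times> UNIV)"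
    using assms(12) TI unfolding C1_on_def by blast
  have inter: "(T, x T) \<in> interior ({a..b} \<times> UNIV)" using T by (simp add: interior_Times)
  have D\<phi>: "((\<lambda>(t, u). \<phi> t u) has_derivative D\<phi>) (at (T, x T))"
    using D\<phi> unfolding at_within_interior[OF inter] .
  interpret D\<phi>: bounded_linear D\<phi> using D\<phi> by (rule has_derivative_bounded_linear)
  define \<phi>1 where "\<phi>1 = D\<phi> (1, 0)"
  define \<phi>2 where "\<phi>2 = D\<phi> (0, 1)"
  have D\<phi>': "((\<lambda>(t, u). \<phi> t u) has_derivative (\<lambda>(p, q). \<phi>1 * p + \<phi>2 * q)) (at (T, x T))"
    using D\<phi> by (rule has_derivative_eq_rhs) (auto simp: fun_eq_iff \<phi>1_def \<phi>2_def mult.commute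
        intro: bounded_linear_real_prod[OF D\<phi>.bounded_linear_axioms, THEN trans])
  have \<phi>2: "deriv (\<lambda>u. \<phi> T u) (x T) = \<phi>2"
  proof (rule DERIV_imp_deriv)
    have "((\<lambda>u. (T, u)) has_derivative (\<lambda>h. (0, h))) (at (x T))" by (auto intro!: derivative_eq_intros)
    from has_derivative_compose[OF this D\<phi>']
    show "((\<lambda>u. \<phi> T u) has_real_derivative \<phi>2) (at (x T))"
      by (simp add: has_field_derivative_def)
  qed
  have \<phi>1: "D_on a b (\<lambda>s. \<phi> s (x T)) T = \<phi>1"
  proof (rule D_on_eq[OF assms(1) TI])
    have "((\<lambda>s. (s, x T)) has_derivative (\<lambda>h. (h, 0))) (at T)" by (auto intro!: derivative_eq_intros)
    from has_derivative_compose[OF this D\<phi>']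
    show "((\<lambda>s. \<phi> s (x T)) has_real_derivative \<phi>1) (at T within {a..b})"
      by (simp add: has_field_derivative_def atT)
  qed
  obtain \<psi>1 where \<psi>1: "(\<psi> has_real_derivative \<psi>1) (at T)"
    using assms(14) TI atT unfolding differentiable_on_def real_differentiable_def by metis
  have \<psi>1': "D_on a b \<psi> T = \<psi>1" by (rule D_on_eq[OF assms(1) TI]) (simp add: atT \<psi>1)
  have xdT: "(x has_real_derivative D_on a b x T) (at T)" using xd(1)[OF TI] atT by simp

  \<comment> \<open>The fundamental lemma is applied with jump constant 0;
    \<open>variation_kernel_eq_zero_imp\<close> then contradicts the assumption that one of the two
    conditions fails.\<close>
  obtain e0 where e0: "continuous_on {a..b} e0" and nz: "integral {a..b} (\<lambda>s. e0 s * variation_kernel gq gp s) \<noteq> 0"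
  proof (rule ccontr)
    assume "\<not> thesis"
    with that have z: "integral {a..b} (\<lambda>s. e s * variation_kernel gq gp s) = 0" if "continuous_on {a..b} e" for e
      using that by blast
    have "variation_kernel gq gp s = 0" if "s \<in> {a..b}" for s
      by (rule du_Bois_Reymond_jump(2)[OF T Vc(2), of 0]) (use z that in auto)
    from variation_kernel_eq_zero_imp[OF qpc(3,4) this] show False
      using assms(18) unfolding gq_def gp_def by blast
  qed

  define IL where "IL e = integral {a..b} (\<lambda>s. e s * variation_kernel Lq Lp s)" for e
  define Ig where "Ig e = integral {a..b} (\<lambda>s. e s * variation_kernel gq gp s)" for e
  \<comment> \<open>\<open>A\<close> and \<open>B\<close> are the rates of change of functional and
    constraint under a pure shift of T. The term with \<open>\<phi>2\<close> arises because the end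
    value x(T) moves along with T.\<close>
  define A where "A = ?al L x T + \<phi>1 + \<phi>2 * D_on a b x T"
  define B where "B = ?al g x T - \<psi>1"
  \<comment> \<open>This is the vanishing of the Jacobian determinant of functional and constraint
    in the two parameters. \<open>e0\<close> is already fixed, while \<open>e\<close> and
    \<open>\<tau>\<close> remain arbitrary.\<close>
  have mult: "(\<tau> * A + IL e + \<phi>2 * integral {a..T} e) * Ig e0 = (IL e0 + \<phi>2 * integral {a..T} e0) * (\<tau> * B + Ig e)"
    if e: "continuous_on {a..b} e" for e \<tau>
  proof -
    obtain r where r: "r > 0"
      "\<And>w. norm w < r \<Longrightarrow> \<bar>fst w * \<tau>\<bar> < min (T - a) (b - T) \<and>
      ((\<lambda>t. x t + fst w * integral {a..t} e + snd w * integral {a..t} e0), T + fst w * \<tau>) \<in> frac_space a b \<alpha> \<beta> \<gamma>1 \<gamma>2 \<and>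
      (\<forall>t\<in>{a..b}. cc (\<lambda>t. x t + fst w * integral {a..t} e + snd w * integral {a..t} e0) t
          = cc x t + fst w * caputo_op e t + snd w * caputo_op e0 t) \<and>
      frac_norm a b \<alpha> \<beta> \<gamma>1 \<gamma>2 (\<lambda>s. x s - (x s + fst w * integral {a..s} e + snd w * integral {a..s} e0))
         (T - (T + fst w * \<tau>)) < \<epsilon>"
      by (rule admissible_variation[OF xF e e0 \<epsilon>, where \<tau> = \<tau>]) (rule that)
    define h where "h t = integral {a..t} e" for t
    define h0 where "h0 t = integral {a..t} e0" for t
    define y where "y w t = x t + fst w * h t + snd w * h0 t" for w t
    define I where "I F w = integral {a..T + fst w * \<tau>}
        (\<lambda>t. F t (x t + fst w * h t + snd w * h0 t) (cc x t + fst w * caputo_op e t + snd w * caputo_op e0 t))"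
      for F :: "real \<Rightarrow> real \<Rightarrow> real \<Rightarrow> real" and w :: "real \<times> real"
    have hd: "(h has_real_derivative e t) (at t within {a..b})" "(h0 has_real_derivative e0 t) (at t within {a..b})"
      if "t \<in> {a..b}" for t
      unfolding h_def h0_def using e e0 that by (auto intro: integral_has_real_derivative)
    have hc: "continuous_on {a..b} h" "continuous_on {a..b} h0"
      using hd DERIV_continuous_on[of "{a..b}" h e] DERIV_continuous_on[of "{a..b}" h0 e0] by blast+
    note c = xc zc hc(1) continuous_on_caputo_op[OF e] hc(2) continuous_on_caputo_op[OF e0]
    note FL = has_derivative_functional[OF T Lc Ld1 assms(10,11) c, where \<tau> = \<tau>]
    note Fg = has_derivative_functional[OF T gc gd1 g1(2,3) c, where \<tau> = \<tau>]
    define J where "J w = I L w + \<phi> (T + fst w * \<tau>) (y w (T + fst w * \<tau>))" for w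
    define G where "G w = I g w - \<psi> (T + fst w * \<tau>)" for w
    have fv: "integral {a..T} (\<lambda>t. q t * h t + p t * caputo_op f t) = integral {a..b} (\<lambda>s. f s * variation_kernel q p s)"
      if "continuous_on {a..b} f" "continuous_on {a..T} q" "continuous_on {a..T} p" "h = (\<lambda>t. integral {a..t} f)" for f h q p
      using first_variation[OF that(1-3)] that(4) by simp
    have IL': "(I L has_derivative (\<lambda>w. fst w * (\<tau> * ?al L x T + IL e) + snd w * IL e0)) (at 0)"
      using FL(1) fv[OF e qpT(1,2), of h] fv[OF e0 qpT(1,2), of h0]
      by (simp add: I_def[abs_def] IL_def h_def[abs_def] h0_def[abs_def] Lq_def Lp_def along_def)
    have Ig': "(I g has_derivative (\<lambda>w. fst w * (\<tau> * ?al g x T + Ig e) + snd w * Ig e0)) (at 0)"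
      using Fg(1) fv[OF e qpT(3,4), of h] fv[OF e0 qpT(3,4), of h0]
      by (simp add: I_def[abs_def] Ig_def h_def[abs_def] h0_def[abs_def] gq_def gp_def along_def)
    have J': "(J has_derivative (\<lambda>w. fst w * (\<tau> * A + IL e + \<phi>2 * h T) + snd w * (IL e0 + \<phi>2 * h0 T))) (at 0)"
      unfolding J_def y_def
      by (rule has_derivative_eq_rhs[OF has_derivative_add[OF IL'
              has_derivative_terminal[OF D\<phi>' xdT hd[OF TI, unfolded atT]]]])
        (auto simp: fun_eq_iff A_def algebra_simps)
    have \<psi>d: "((\<lambda>w. \<psi> (T + fst w * \<tau>)) has_derivative (\<lambda>w. fst w * \<tau> * \<psi>1)) (at (0 :: real \<times> real))"
    proof -
      have s: "((\<lambda>w. T + fst w * \<tau>) has_derivative (\<lambda>w. fst w * \<tau>)) (at (0 :: real \<times> real))"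
        by (auto intro!: derivative_eq_intros)
      show ?thesis
        using has_derivative_compose[OF s, of \<psi> "(*) \<psi>1"] \<psi>1
        by (simp add: has_field_derivative_def mult_ac)
    qed
    have G': "(G has_derivative (\<lambda>w. fst w * (\<tau> * B + Ig e) + snd w * Ig e0)) (at 0)"
      unfolding G_def
      by (rule has_derivative_eq_rhs[OF has_derivative_diff[OF Ig' \<psi>d]])
        (auto simp: fun_eq_iff B_def algebra_simps)
    \<comment> \<open>The formula for the combined Caputo derivative of the varied function is known
      on [a, b] only, so the integrands are compared on the actual range of integration, which lies
      inside.\<close>
    have LB: "(LBINT t:{a..T + fst w * \<tau>}. ?al F (y w) t) = I F w"
      if w: "norm w < r" and F: "continuous_on {a..T + fst w * \<tau>}
        (\<lambda>t. F t (x t + fst w * h t + snd w * h0 t) (cc x t + fst w * caputo_op e t + snd w * caputo_op e0 t))" for F w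
    proof -
      have eq: "?al F (y w) t = F t (x t + fst w * h t + snd w * h0 t) (cc x t + fst w * caputo_op e t + snd w * caputo_op e0 t)"
        if "t \<in> {a..T + fst w * \<tau>}" for t
        using r(2)[OF w] that unfolding along_def y_def[abs_def] h_def h0_def by auto
      have "(LBINT t:{a..T + fst w * \<tau>}. ?al F (y w) t) = (LBINT t:{a..T + fst w * \<tau>}.
          F t (x t + fst w * h t + snd w * h0 t) (cc x t + fst w * caputo_op e t + snd w * caputo_op e0 t))"
        by (rule set_lebesgue_integral_cong) (use eq in auto)
      then show ?thesis using cutoff_integral(3)[OF F] by (simp add: I_def)
    qed
    have Tw: "T + fst w * \<tau> \<le> b" if "norm w < r" for w :: "real \<times> real"
      using r(2)[OF that] by auto
    have LBL: "(LBINT t:{a..T + fst w * \<tau>}. ?al L (y w) t) = I L w"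
      and LBg: "(LBINT t:{a..T + fst w * \<tau>}. ?al g (y w) t) = I g w" if "norm w < r" for w
      by (rule LB, rule that, rule FL(2) Fg(2), rule Tw, rule that)+
    have y0: "y 0 = x" by (simp add: y_def fun_eq_iff)
    have "(\<lambda>w. fst w * (\<tau> * A + IL e + \<phi>2 * h T) + snd w * (IL e0 + \<phi>2 * h0 T)) (1, 0)
        * (\<lambda>w. fst w * (\<tau> * B + Ig e) + snd w * Ig e0) (0, 1)
      = (\<lambda>w. fst w * (\<tau> * A + IL e + \<phi>2 * h T) + snd w * (IL e0 + \<phi>2 * h0 T)) (0, 1)
        * (\<lambda>w. fst w * (\<tau> * B + Ig e) + snd w * Ig e0) (1, 0)"
    proof (rule multiplier_rule[OF J' G' _ _ r(1)])
      show "G 0 = 0" using LBg[of 0] r(1) xg by (simp add: G_def y0)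
      show "fst (0 :: real, 1 :: real) * (\<tau> * B + Ig e) + snd (0 :: real, 1 :: real) * Ig e0 \<noteq> 0"
        using nz by (simp add: Ig_def)
      show "continuous_on {q. norm (p, q) < r} (\<lambda>q. G (p, q))" for p :: real
      \<comment> \<open>If the slice is empty there is nothing to prove; otherwise any of its points
        certifies that T + p \<tau> is at most b, so that the integral is continuous in q.\<close>
      proof (cases "\<exists>q :: real. norm (p, q) < r")
        case True
        then obtain q :: real where "norm (p, q) < r" by blast
        from Tw[OF this] have "T + p * \<tau> \<le> b" by simp
        from Fg(3)[OF this] have "continuous_on UNIV (\<lambda>q. G (p, q))"
          unfolding G_def I_def by (auto intro!: continuous_intros)
        then show ?thesis by (rule continuous_on_subset) simp
      qed auto
      show "J 0 \<le> J w" if w: "norm w < r" and G: "G w = 0" for w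
      proof -
        have bJ: "bolza a b \<alpha> \<beta> \<gamma>1 \<gamma>2 L \<phi> (y w) (T + fst w * \<tau>) = J w" if "norm w < r" for w
          using LBL[OF that] by (simp add: bolza_def J_def)
        have "y w a = xa" using xxa by (simp add: y_def h_def h0_def)
        moreover have "(y w, T + fst w * \<tau>) \<in> frac_space a b \<alpha> \<beta> \<gamma>1 \<gamma>2"
          using r(2)[OF w] by (simp add: y_def[abs_def] h_def h0_def)
        moreover have "(LBINT t:{a..T + fst w * \<tau>}. ?al g (y w) t) = \<psi> (T + fst w * \<tau>)"
          using LBg[OF w] G by (simp add: G_def)
        ultimately have "(y w, T + fst w * \<tau>) \<in> admissible a b \<alpha> \<beta> \<gamma>1 \<gamma>2 g \<psi> xa"
          by (simp add: admissible_def)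
        moreover have "frac_norm a b \<alpha> \<beta> \<gamma>1 \<gamma>2 (\<lambda>s. x s - y w s) (T - (T + fst w * \<tau>)) < \<epsilon>"
          using r(2)[OF w] by (simp add: y_def h_def h0_def)
        ultimately have "bolza a b \<alpha> \<beta> \<gamma>1 \<gamma>2 L \<phi> x T \<le> J w"
          using min bJ[OF w] by metis
        then show ?thesis using bJ[of 0] r(1) by (simp add: y0)
      qed
    qed
    then show ?thesis by (simp add: h_def h0_def)
  qed

  define l where "l = (IL e0 + \<phi>2 * integral {a..T} e0) / Ig e0"
  have nz': "Ig e0 \<noteq> 0" using nz by (simp add: Ig_def)
  have lag: "\<tau> * A + IL e + \<phi>2 * integral {a..T} e = l * (\<tau> * B + Ig e)"
    if "continuous_on {a..b} e" for e \<tau>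
    using mult[OF that, of \<tau>] nz' by (simp add: l_def field_simps)
  \<comment> \<open>Only T moves: e = 0 and \<tau> = 1.\<close>
  have AB: "A = l * B"
    using lag[of "\<lambda>_. 0" 1] by (simp add: IL_def Ig_def)
  define W where "W s = variation_kernel Lq Lp s + (- l) * variation_kernel gq gp s" for s
  have Wc: "continuous_on {a..b} W" unfolding W_def by (intro continuous_intros Vc)
  \<comment> \<open>Only x moves: \<tau> = 0. \<open>W\<close> is the variation kernel belonging to
    F = L - l g.\<close>
  have Wz: "integral {a..b} (\<lambda>s. e s * W s) + \<phi>2 * integral {a..T} e = 0" if e: "continuous_on {a..b} e" for e
  proof -
    have "integral {a..b} (\<lambda>s. e s * W s) = integral {a..b} (\<lambda>s. e s * variation_kernel Lq Lp s - l * (e s * variation_kernel gq gp s))"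
      by (simp add: W_def algebra_simps)
    also have "\<dots> = IL e - l * Ig e"
      unfolding IL_def Ig_def
      by (subst Henstock_Kurzweil_Integration.integral_diff)
        (auto intro!: integrable_continuous_real continuous_intros e Vc)
    finally show ?thesis using lag[OF e, of 0] by simp
  qed
  note dB = du_Bois_Reymond_jump[OF T Wc Wz]
  define F where "F = (\<lambda>t u v. L t u v - l * g t u v)"
  define p where "p = ?al (pd3 F) x"
  have p: "p t = Lp t + (- l) * gp t" if "t \<in> {a..b}" for t
  proof -
    have "((\<lambda>v. F t (x t) v) has_real_derivative pd3 L t (x t) (cc x t) - l * pd3 g t (x t) (cc x t)) (at (cc x t))"
      unfolding F_def by (intro DERIV_diff DERIV_cmult Ld(3) gd(3) that)
    then show ?thesis
      unfolding p_def Lp_def gp_def along_def pd3_def[of F] by (simp add: DERIV_imp_deriv)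
  qed
  have pc: "continuous_on {a..b} (\<lambda>t. Lp t + (- l) * gp t)" by (intro continuous_intros qpc)
  then have pc: "continuous_on {a..b} p" by (rule continuous_on_eq) (simp add: p)
  \<comment> \<open>\<open>p\<close> is known to equal the combination of \<open>Lp\<close> and
    \<open>gp\<close> only on [a, b]. The variation kernel sees it through its cutoff, so this is
    enough.\<close>
  have "cutoff a T p = cutoff a T (\<lambda>s. Lp s + (- l) * gp s)"
    by (rule cutoff_cong) (use p T in auto)
  then have "variation_kernel (\<lambda>s. Lq s + (- l) * gq s) p b = W b"
    using variation_kernel_add[OF qpT(1,2,3,4), of "- l" b] by (simp add: variation_kernel_def W_def)
  then have "\<gamma>2 * (RL_left_int \<beta> a p b - RL_left_int \<beta> T p b) = 0"
    using variation_kernel_beyond[OF pc, of b] dB(2)[of b] assms(1) T by auto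
  then have c3: "\<gamma>2 * (RL_left_int \<beta> T p b - RL_left_int \<beta> a p b) = 0"
    by auto
  \<comment> \<open>With \<open>\<phi>2 = 0\<close> the identity A = l B loses its x'(T) term, in
    accordance with the bracket multiplied by x'(T) in the first condition, which is 0.\<close>
  have c1: "?al F x T + \<phi>1 + l * \<psi>1 = 0"
    using AB dB(1) by (simp add: A_def B_def F_def along_def algebra_simps)
  show ?thesis
    by (intro exI[of _ l], unfold Let_def F_def[symmetric] p_def[symmetric])
      (use c1 c3 dB(1) in \<open>simp add: RL_int_self \<phi>1 \<phi>2 \<psi>1'\<close>)
qed

end
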